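(* Let $H$ be a chordal graph, let $t \geq 1$, and let $G = \mathrm{CCG}(H, V(H), t)$. If $r$ is a positive integer with $r \leq 2t+1$, then the $r$-independence complex $\mathrm{Ind}_r(G)$ is shellable.
   Context: All graphs are finite and simple; a graph is chordal if every cycle of length at least 4 has a chord. A star-clique graph $\mathrm{SC}(x)$ is a graph formed by attaching a collection of cliques $B_1,\dots,B_m$ (complete graphs, possibly of different sizes) to a central vertex $x$, i.e. each $B_i$ contains $x$ and the $B_i$ share no other vertices. For a vertex cover $S$ of $H$ and integer $t\ge1$, $\mathrm{CCG}(H,S,t)$ is the graph obtained from $H$ by attaching to each vertex $x \in S$ a star-clique graph $\mathrm{SC}(x)$ with center $x$ and $|V(\mathrm{SC}(x))| \geq t+1$, whose vertices other than $x$ are new (not in $H$ and not in any other attached star-clique). For $r \geq 1$, a subset $A \subseteq V(G)$ is $r$-independent if every connected component of $G[A]$ has at most $r$ vertices; $\mathrm{Ind}_r(G)$ is the simplicial complex on $V(G)$ of all $r$-independent subsets. A (not necessarily pure) simplicial complex is shellable if its facets can be ordered $F_1,\dots,F_k$ so that for each $j>1$, $\langle F_j\rangle \cap \langle F_1,\dots,F_{j-1}\rangle$ is pure of dimension $\dim F_j-1$ ($\langle\mathcal F\rangle$ = complex generated by $\mathcal F$). *)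

theory Defs
  imports "Graph_Theory.Graph_Theory"
begin

text \<open>
  A finite simple graph is a symmetric, loop-free, finite pair digraph, i.e. an
  \<^typ>\<open>'a pair_pre_digraph\<close> satisfying \<^const>\<open>pair_graph\<close>: each undirected
  edge is represented by its two orientations.
\<close>

section \<open>Chordal graphs\<close>

text \<open>
  Cycles are lists of arcs. In a symmetric digraph the list \<open>[(u,v), (v,u)]\<close> is also a
  library cycle, but in length at least 4 the cycles are exactly the oriented graph cycles.
  A chord joins two vertices of the cycle and is, in neither orientation, one of its edges.
\<close>
definition chordal :: "'a pair_pre_digraph \<Rightarrow> bool" where
  "chordal G \<longleftrightarrow>
     (\<forall>p. pre_digraph.cycle (with_proj G) p \<and> length p \<ge> 4 \<longrightarrow>
       (\<exists>u \<in> fst ` set p. \<exists>v \<in> fst ` set p.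
          (u, v) \<in> parcs G \<and> (u, v) \<notin> set p \<and> (v, u) \<notin> set p))"

section \<open>Attaching star-clique graphs\<close>

definition vertex_cover :: "'a pair_pre_digraph \<Rightarrow> 'a set \<Rightarrow> bool" where
  "vertex_cover H S \<longleftrightarrow> S \<subseteq> pverts H \<and> (\<forall>(u, v) \<in> parcs H. u \<in> S \<or> v \<in> S)"

text \<open>\<open>\<B>\<close> is the collection of the vertex sets of the cliques.\<close>
definition star_clique :: "'a \<Rightarrow> 'a pair_pre_digraph \<Rightarrow> bool" where
  "star_clique x K \<longleftrightarrow> pair_graph K \<and>
     (\<exists>\<B>. \<B> \<noteq> {} \<and> (\<forall>B \<in> \<B>. x \<in> B) \<and> pairwise (\<lambda>B C. B \<inter> C = {x}) \<B> \<and>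
        pverts K = \<Union>\<B> \<and>
        parcs K = {(u, v). u \<noteq> v \<and> (\<exists>B \<in> \<B>. u \<in> B \<and> v \<in> B)})"

text \<open>
  \<open>ccg H S t G\<close>: \<open>G\<close> is one of the graphs denoted $\mathrm{CCG}(H,S,t)$. This is a relation
  because the sizes and numbers of the attached cliques are free.
\<close>
definition ccg :: "'a pair_pre_digraph \<Rightarrow> 'a set \<Rightarrow> nat \<Rightarrow> 'a pair_pre_digraph \<Rightarrow> bool" where
  "ccg H S t G \<longleftrightarrow> vertex_cover H S \<and>
     (\<exists>SC :: 'a \<Rightarrow> 'a pair_pre_digraph.
        (\<forall>x \<in> S. star_clique x (SC x) \<and> card (pverts (SC x)) \<ge> t + 1 \<and>
           pverts (SC x) \<inter> pverts H = {x}) \<and>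
        (\<forall>x \<in> S. \<forall>y \<in> S. x \<noteq> y \<longrightarrow> pverts (SC x) \<inter> pverts (SC y) = {}) \<and>
        pverts G = pverts H \<union> (\<Union>x \<in> S. pverts (SC x)) \<and>
        parcs G = parcs H \<union> (\<Union>x \<in> S. parcs (SC x)))"

section \<open>Shellable simplicial complexes\<close>

text \<open>Finite abstract simplicial complexes, given by their sets of faces.\<close>
definition simplicial_complex :: "'a set set \<Rightarrow> bool" where
  "simplicial_complex \<Delta> \<longleftrightarrow> finite \<Delta> \<and> (\<forall>F \<in> \<Delta>. finite F \<and> (\<forall>E. E \<subseteq> F \<longrightarrow> E \<in> \<Delta>))"

definition facets :: "'a set set \<Rightarrow> 'a set set" where
  "facets \<Delta> = {F \<in> \<Delta>. \<forall>E \<in> \<Delta>. F \<subseteq> E \<longrightarrow> E = F}"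

definition generated_complex :: "'a set set \<Rightarrow> 'a set set" where
  "generated_complex \<F> = {E. \<exists>F \<in> \<F>. E \<subseteq> F}"

text \<open>The empty face has dimension \<open>-1\<close>; hence the values in \<^typ>\<open>int\<close>.\<close>
definition face_dim :: "'a set \<Rightarrow> int" where
  "face_dim F = int (card F) - 1"

definition pure_of_dim :: "'a set set \<Rightarrow> int \<Rightarrow> bool" where
  "pure_of_dim \<Delta> d \<longleftrightarrow> (\<forall>F \<in> facets \<Delta>. face_dim F = d)"

text \<open>The list \<open>Fs\<close> is 0-based, so the condition for $j > 1$ becomes one for \<open>0 < j\<close>.\<close>
definition shellable :: "'a set set \<Rightarrow> bool" where
  "shellable \<Delta> \<longleftrightarrow> simplicial_complex \<Delta> \<and>
     (\<exists>Fs. distinct Fs \<and> set Fs = facets \<Delta> \<and>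
        (\<forall>j. 0 < j \<and> j < length Fs \<longrightarrow>
           pure_of_dim (generated_complex {Fs ! j} \<inter> generated_complex (set (take j Fs)))
             (face_dim (Fs ! j) - 1)))"

section \<open>The r-independence complex\<close>

text \<open>
  For a symmetric digraph the strongly connected components of \<open>G \<restriction> A\<close> are the connected
  components of the induced subgraph.
\<close>
definition r_independent :: "nat \<Rightarrow> 'a pair_pre_digraph \<Rightarrow> 'a set \<Rightarrow> bool" where
  "r_independent r G A \<longleftrightarrow> A \<subseteq> pverts G \<and>
     (\<forall>C \<in> pre_digraph.sccs (with_proj G \<restriction> A). card (verts C) \<le> r)"

definition Ind :: "nat \<Rightarrow> 'a pair_pre_digraph \<Rightarrow> 'a set set" where
  "Ind r G = {A. r_independent r G A}"

lemma r_independent_subset: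
  assumes G: "pair_graph G" and A: "r_independent r G A" and BA: "B \<subseteq> A"
  shows "r_independent r G B"
proof -
  interpret pair_graph G by (rule G)
  interpret GA: wf_digraph "with_proj G \<restriction> A" by (rule wellformed_induce_subgraph)
  interpret GB: wf_digraph "with_proj G \<restriction> B" by (rule wellformed_induce_subgraph)
  have AG: "A \<subseteq> pverts G" using A by (simp add: r_independent_def)
  then have "finite A" using finite_subset pair_finite_verts by blast
  have "card (verts C) \<le> r" if "C \<in> GB.sccs" for C
  proof -
    from that have "verts C \<in> GB.sccs_verts" by (auto simp: GB.sccs_verts_conv)
    then obtain u where u: "u \<in> B" and C: "verts C = GB.scc_of u"
      by (auto simp: GB.sccs_verts_conv_scc_of)
    have "GA.scc_of u \<in> GA.sccs_verts"
      using u BA by (intro GA.scc_of_in_sccs_verts) auto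
    then obtain D where D: "D \<in> GA.sccs" and Du: "verts D = GA.scc_of u"
      by (auto simp: GA.sccs_verts_conv)
    have "verts C \<subseteq> verts D"
      using BA unfolding C Du GA.scc_of_def GB.scc_of_def
      by (auto intro: reachable_induce_ss)
    moreover have "verts D \<subseteq> A"
      using GA.sccs_verts_subsets \<open>GA.scc_of u \<in> GA.sccs_verts\<close> Du by auto
    then have "finite (verts D)" using \<open>finite A\<close> finite_subset by blast
    ultimately have "card (verts C) \<le> card (verts D)" by (simp add: card_mono)
    also have "\<dots> \<le> r" using A D by (auto simp: r_independent_def)
    finally show ?thesis .
  qed
  then show ?thesis using AG BA by (auto simp: r_independent_def)
qed

lemma simplicial_complex_Ind:
  assumes "pair_graph G"
  shows "simplicial_complex (Ind r G)"
proof -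
  interpret pair_graph G by (rule assms)
  have "Ind r G \<subseteq> Pow (pverts G)" by (auto simp: Ind_def r_independent_def)
  moreover from this have "finite F" if "F \<in> Ind r G" for F
    using that pair_finite_verts finite_subset by blast
  moreover have "E \<in> Ind r G" if "F \<in> Ind r G" "E \<subseteq> F" for E F
    using that r_independent_subset[OF assms] by (auto simp: Ind_def)
  ultimately show ?thesis
    using pair_finite_verts unfolding simplicial_complex_def
    by (meson finite_Pow_iff finite_subset)
qed

end

theory Submission
  imports Defs
begin

text \<open>
  Vertices of \<open>H\<close> are decided one at a time: with \<open>D\<close> forced in and \<open>U\<close> undecided, the faces are
  the \<open>A\<close> with \<open>A \<union> D\<close> \<open>r\<close>-independent, and \<open>A\<close> contained in \<open>U\<close> plus all clique vertices
  outside \<open>H\<close>; link and deletion at \<open>u \<in> U\<close> have the same form. If \<open>u\<close> could be added to a facet of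
  the deletion, then by an exchange argument its component contains every undecided simplicial
  vertex next to it, in particular the whole star-clique of each of its \<open>H\<close>-vertices. Two such
  star-cliques have at least \<open>2t + 2 > r\<close> vertices, so \<open>u\<close> is a shedding vertex whenever such a
  component would contain a second vertex of \<open>H\<close>. Hence \<open>u\<close> can be shed if it has a neighbour in
  \<open>D\<close>. Otherwise take \<open>x\<close> simplicial in \<open>H[U]\<close> (Dirac): shed \<open>x\<close> if its star-clique has more than
  \<open>r\<close> vertices, else shed a neighbour of \<open>x\<close> in \<open>U\<close>; if there is none, \<open>x\<close> is a cone point.
\<close>

section \<open>Shellings\<close>

text \<open>An elementwise form of the purity condition, which has the advantage of being stable under
  joining a vertex to all facets.\<close>
definition shelling :: "'a set list \<Rightarrow> bool" where
  "shelling Fs \<longleftrightarrow> (\<forall>j < length Fs. \<forall>i < j. \<exists>k < j. \<exists>x \<in> Fs ! j.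
     Fs ! i \<inter> Fs ! j \<subseteq> Fs ! j - {x} \<and> Fs ! j - {x} \<subseteq> Fs ! k)"

lemma shellingE:
  assumes "shelling Fs" "j < length Fs" "i < j"
  obtains k x where "k < j" "x \<in> Fs ! j" "Fs ! i \<inter> Fs ! j \<subseteq> Fs ! j - {x}"
    "Fs ! j - {x} \<subseteq> Fs ! k"
  using assms unfolding shelling_def by blast

definition has_shelling :: "'a set set \<Rightarrow> bool" where
  "has_shelling \<Delta> \<longleftrightarrow> (\<exists>Fs. distinct Fs \<and> set Fs = facets \<Delta> \<and> shelling Fs)"

text \<open>A facet of the intersection lies in some \<open>Fs ! i \<inter> Fs ! j\<close>, hence in
  \<open>Fs ! j - {x}\<close>, which is itself a face of the intersection; by maximality the two
  agree.\<close>

lemma has_shelling_imp_shellable: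
  assumes complex: "simplicial_complex \<Delta>" and "has_shelling \<Delta>"
  shows "shellable \<Delta>"
proof -
  obtain Fs where Fs: "distinct Fs" "set Fs = facets \<Delta>" "shelling Fs"
    using assms(2) by (auto simp: has_shelling_def)
  have "pure_of_dim (generated_complex {Fs ! j} \<inter> generated_complex (set (take j Fs)))
          (face_dim (Fs ! j) - 1)" if j: "j < length Fs" for j
    unfolding pure_of_dim_def
  proof
    let ?I = "generated_complex {Fs ! j} \<inter> generated_complex (set (take j Fs))"
    fix E assume E: "E \<in> facets ?I"
    then have "E \<subseteq> Fs ! j" "\<exists>F \<in> set (take j Fs). E \<subseteq> F"
      by (auto simp: facets_def generated_complex_def)
    then obtain i where i: "i < j" "E \<subseteq> Fs ! i" "E \<subseteq> Fs ! j"
      by (auto simp: in_set_conv_nth)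
    then obtain k x where k: "k < j" "x \<in> Fs ! j" "Fs ! i \<inter> Fs ! j \<subseteq> Fs ! j - {x}"
        "Fs ! j - {x} \<subseteq> Fs ! k"
      using shellingE[OF Fs(3) j i(1)] by blast
    have "Fs ! k \<in> set (take j Fs)"
      using k(1) j nth_mem[of k "take j Fs"] by simp
    then have "Fs ! j - {x} \<in> ?I" using k(4) by (auto simp: generated_complex_def)
    then have "E = Fs ! j - {x}" using E i k(3) unfolding facets_def by blast
    moreover have "finite (Fs ! j)"
      using nth_mem[OF j] Fs(2) complex by (simp add: facets_def simplicial_complex_def)
    moreover from this have "card (Fs ! j) > 0" using k(2) by (auto simp: card_gt_0_iff)
    ultimately show "face_dim E = face_dim (Fs ! j) - 1"
      using k(2) by (simp add: face_dim_def card_Diff_singleton)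
  qed
  then show ?thesis using complex Fs by (auto simp: shellable_def)
qed

lemma face_subset_facet:
  assumes "finite \<Delta>" "A \<in> \<Delta>"
  shows "\<exists>F \<in> facets \<Delta>. A \<subseteq> F"
proof -
  obtain F where "F \<in> \<Delta>" "A \<subseteq> F" "\<And>E. E \<in> \<Delta> \<Longrightarrow> F \<subseteq> E \<Longrightarrow> F = E"
    using finite_has_maximal2[OF assms] by metis
  then show ?thesis by (auto simp: facets_def)
qed

lemma has_shelling_Pow: "has_shelling (Pow A)"
proof -
  have "facets (Pow A) = {A}" by (auto simp: facets_def)
  then have "distinct [A]" "set [A] = facets (Pow A)" "shelling [A]" by (auto simp: shelling_def)
  then show ?thesis unfolding has_shelling_def by blast
qed

text \<open>The complex without any face has to be covered too: \<open>r_ext\<close> yields it when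
  the forced set alone is not r-independent.\<close>

lemma has_shelling_empty: "has_shelling {}"
proof -
  have "distinct []" "set [] = facets {}" "shelling []" by (auto simp: shelling_def facets_def)
  then show ?thesis unfolding has_shelling_def by blast
qed

section \<open>Shedding vertices and cone points\<close>

definition link :: "'a \<Rightarrow> 'a set set \<Rightarrow> 'a set set" where
  "link v \<Delta> = {A. v \<notin> A \<and> insert v A \<in> \<Delta>}"

definition deletion :: "'a \<Rightarrow> 'a set set \<Rightarrow> 'a set set" where
  "deletion v \<Delta> = {A \<in> \<Delta>. v \<notin> A}"

lemma shelling_map_insert:
  assumes "shelling Fs" "\<And>F. F \<in> set Fs \<Longrightarrow> v \<notin> F"
  shows "shelling (map (insert v) Fs)"
  unfolding shelling_def
proof (intro allI impI)
  fix j i assume j: "j < length (map (insert v) Fs)" and "i < j"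
  then obtain k x where k: "k < j" "x \<in> Fs ! j" "Fs ! i \<inter> Fs ! j \<subseteq> Fs ! j - {x}"
      "Fs ! j - {x} \<subseteq> Fs ! k"
    using shellingE[OF assms(1)] by (metis length_map)
  moreover have "x \<noteq> v" using assms(2) j k(2) nth_mem by fastforce
  ultimately show "\<exists>k<j. \<exists>x\<in>map (insert v) Fs ! j.
      map (insert v) Fs ! i \<inter> map (insert v) Fs ! j \<subseteq> map (insert v) Fs ! j - {x} \<and>
      map (insert v) Fs ! j - {x} \<subseteq> map (insert v) Fs ! k"
    using j \<open>i < j\<close> by (intro exI[of _ k] conjI bexI[of _ x]) (simp_all, blast+)
qed

text \<open>Pairs inside one of the lists keep their own witness; only a facet of \<open>Ls\<close>
  compared with one of \<open>Fs\<close> calls for a new one.\<close>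

lemma shelling_append:
  assumes "shelling Fs" "shelling Ls"
    and new: "\<And>F L. F \<in> set Fs \<Longrightarrow> L \<in> set Ls \<Longrightarrow>
      \<exists>x \<in> L. F \<inter> L \<subseteq> L - {x} \<and> (\<exists>F' \<in> set Fs. L - {x} \<subseteq> F')"
  shows "shelling (Fs @ Ls)"
  unfolding shelling_def
proof (intro allI impI)
  fix j i assume j: "j < length (Fs @ Ls)" and i: "i < j"
  let ?n = "length Fs"
  show "\<exists>k<j. \<exists>x\<in>(Fs @ Ls) ! j. (Fs @ Ls) ! i \<inter> (Fs @ Ls) ! j \<subseteq> (Fs @ Ls) ! j - {x} \<and>
      (Fs @ Ls) ! j - {x} \<subseteq> (Fs @ Ls) ! k"
  proof (cases "j < ?n")
    case True
    then obtain k x where "k < j" "x \<in> Fs ! j" "Fs ! i \<inter> Fs ! j \<subseteq> Fs ! j - {x}"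
        "Fs ! j - {x} \<subseteq> Fs ! k"
      using shellingE[OF assms(1) True i] by blast
    moreover have "(Fs @ Ls) ! l = Fs ! l" if "l \<le> j" for l using that True by (simp add: nth_append)
    ultimately show ?thesis using i by (metis less_imp_le order_refl)
  next
    case False
    show ?thesis
    proof (cases "i < ?n")
      case True
      then have "Fs ! i \<in> set Fs" "Ls ! (j - ?n) \<in> set Ls" using j False by auto
      from new[OF this] obtain x k where xk: "x \<in> Ls ! (j - ?n)"
          "Fs ! i \<inter> Ls ! (j - ?n) \<subseteq> Ls ! (j - ?n) - {x}"
          "k < ?n" "Ls ! (j - ?n) - {x} \<subseteq> Fs ! k"
        by (auto simp: in_set_conv_nth)
      have "(Fs @ Ls) ! i = Fs ! i" "(Fs @ Ls) ! j = Ls ! (j - ?n)" "(Fs @ Ls) ! k = Fs ! k" "k < j"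
        using True False xk(3) by (simp_all add: nth_append)
      then show ?thesis using xk by metis
    next
      case i': False
      have "j - ?n < length Ls" "i - ?n < j - ?n" using j i i' False by auto
      then obtain k x where k: "k < j - ?n" "x \<in> Ls ! (j - ?n)"
          "Ls ! (i - ?n) \<inter> Ls ! (j - ?n) \<subseteq> Ls ! (j - ?n) - {x}"
          "Ls ! (j - ?n) - {x} \<subseteq> Ls ! k"
        using shellingE[OF assms(2)] by blast
      have "(Fs @ Ls) ! i = Ls ! (i - ?n)" "(Fs @ Ls) ! j = Ls ! (j - ?n)"
          "(Fs @ Ls) ! (?n + k) = Ls ! k" "?n + k < j"
        using False i' k(1) by (simp_all add: nth_append)
      then show ?thesis using k by metis
    qed
  qed
qed

text \<open>The shedding condition keeps every facet of the deletion maximal. The facets through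
  \<open>v\<close> correspond to those of the link in any case.\<close>

lemma facets_deletion_link:
  assumes down: "\<And>A B. A \<in> \<Delta> \<Longrightarrow> B \<subseteq> A \<Longrightarrow> B \<in> \<Delta>"
    and shed: "\<And>F. F \<in> facets (deletion v \<Delta>) \<Longrightarrow> insert v F \<notin> \<Delta>"
  shows "facets \<Delta> = facets (deletion v \<Delta>) \<union> insert v ` facets (link v \<Delta>)"
proof (intro set_eqI iffI)
  fix F assume F: "F \<in> facets \<Delta>"
  show "F \<in> facets (deletion v \<Delta>) \<union> insert v ` facets (link v \<Delta>)"
  proof (cases "v \<in> F")
    case True
    have "F - {v} \<in> facets (link v \<Delta>)"
      unfolding facets_def link_def
    proof (intro CollectI conjI ballI impI)
      show "v \<notin> F - {v}" by simp
      show "insert v (F - {v}) \<in> \<Delta>" using F True by (simp add: facets_def insert_absorb)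
      fix E assume E: "E \<in> {A. v \<notin> A \<and> insert v A \<in> \<Delta>}" "F - {v} \<subseteq> E"
      then have "insert v E \<in> \<Delta>" "F \<subseteq> insert v E" by auto
      then have "insert v E = F" using F by (simp add: facets_def)
      then show "E = F - {v}" using E by auto
    qed
    then have "insert v (F - {v}) \<in> insert v ` facets (link v \<Delta>)" by (rule imageI)
    then show ?thesis using True by (simp add: insert_absorb)
  next
    case False
    then show ?thesis using F unfolding facets_def deletion_def by auto
  qed
next
  fix F assume "F \<in> facets (deletion v \<Delta>) \<union> insert v ` facets (link v \<Delta>)"
  then show "F \<in> facets \<Delta>"
  proof
    assume F: "F \<in> facets (deletion v \<Delta>)"
    have "E = F" if "E \<in> \<Delta>" "F \<subseteq> E" for E
    proof -
      have "v \<notin> E" using shed[OF F] down[OF that(1), of "insert v F"] that(2) by auto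
      then show ?thesis using F that unfolding facets_def deletion_def by auto
    qed
    then show ?thesis using F unfolding facets_def deletion_def by auto
  next
    assume "F \<in> insert v ` facets (link v \<Delta>)"
    then obtain L where L: "F = insert v L" "L \<in> facets (link v \<Delta>)" by auto
    have "E = F" if "E \<in> \<Delta>" "F \<subseteq> E" for E
    proof -
      have "v \<in> E" using that L(1) by auto
      then have "E - {v} \<in> link v \<Delta>" "L \<subseteq> E - {v}"
        using that L unfolding facets_def link_def by (auto simp: insert_absorb)
      then have "E - {v} = L" using L(2) unfolding facets_def by auto
      then show ?thesis using L(1) \<open>v \<in> E\<close> by auto
    qed
    then show ?thesis using L unfolding facets_def link_def by auto
  qed
qed

text \<open>The facets of the deletion come first, followed by \<open>v\<close> joined to those of
  the link. In a mixed pair the vertex to remove is \<open>v\<close>.\<close>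

lemma has_shelling_shedding:
  assumes fin: "finite \<Delta>" and down: "\<And>A B. A \<in> \<Delta> \<Longrightarrow> B \<subseteq> A \<Longrightarrow> B \<in> \<Delta>"
    and shed: "\<And>F. F \<in> facets (deletion v \<Delta>) \<Longrightarrow> insert v F \<notin> \<Delta>"
    and "has_shelling (deletion v \<Delta>)" "has_shelling (link v \<Delta>)"
  shows "has_shelling \<Delta>"
proof -
  obtain Fs where Fs: "distinct Fs" "set Fs = facets (deletion v \<Delta>)" "shelling Fs"
    using assms(4) by (auto simp: has_shelling_def)
  obtain Ls where Ls: "distinct Ls" "set Ls = facets (link v \<Delta>)" "shelling Ls"
    using assms(5) by (auto simp: has_shelling_def)
  have vF: "v \<notin> F" if "F \<in> set Fs" for F
    using that Fs(2) by (auto simp: facets_def deletion_def)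
  have vL: "v \<notin> L" if "L \<in> set Ls" for L
    using that Ls(2) by (auto simp: facets_def link_def)
  have "inj_on (insert v) (set Ls)" using vL by (intro inj_onI) (metis insert_ident)
  then have "distinct (Fs @ map (insert v) Ls)"
    using Fs(1) Ls(1) vF by (auto simp: distinct_map)
  moreover have "set (Fs @ map (insert v) Ls) = facets \<Delta>"
    using facets_deletion_link[OF down shed] Fs Ls by auto
  moreover have "shelling (Fs @ map (insert v) Ls)"
  proof (intro shelling_append Fs shelling_map_insert Ls vL)
    fix F L assume F: "F \<in> set Fs" and "L \<in> set (map (insert v) Ls)"
    then obtain L' where L': "L = insert v L'" "L' \<in> set Ls" by auto
    \<comment> \<open>Each link facet is a face of the deletion and so extends to one of the facets
      already listed.\<close>
    have "L' \<in> deletion v \<Delta>"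
      using L' Ls(2) down[of "insert v L'" L'] by (auto simp: facets_def link_def deletion_def)
    moreover have "finite (deletion v \<Delta>)" using fin by (auto simp: deletion_def)
    ultimately obtain F' where "F' \<in> set Fs" "L' \<subseteq> F'"
      using face_subset_facet Fs(2) by metis
    then show "\<exists>x\<in>L. F \<inter> L \<subseteq> L - {x} \<and> (\<exists>F'\<in>set Fs. L - {x} \<subseteq> F')"
      using L'(1) vF[OF F] vL[OF L'(2)] by (intro bexI[of _ v]) auto
  qed auto
  ultimately show ?thesis unfolding has_shelling_def by blast
qed

text \<open>At a cone point the shedding condition fails for every facet of the deletion, hence a
  separate rule. All facets contain \<open>v\<close>, so a shelling of the link lifts
  directly.\<close>

lemma has_shelling_cone:
  assumes cone: "\<And>A. A \<in> \<Delta> \<Longrightarrow> insert v A \<in> \<Delta>" and down: "\<And>A B. A \<in> \<Delta> \<Longrightarrow> B \<subseteq> A \<Longrightarrow> B \<in> \<Delta>"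
    and "has_shelling (link v \<Delta>)"
  shows "has_shelling \<Delta>"
proof -
  obtain Ls where Ls: "distinct Ls" "set Ls = facets (link v \<Delta>)" "shelling Ls"
    using assms(3) by (auto simp: has_shelling_def)
  have vL: "v \<notin> L" if "L \<in> set Ls" for L
    using that Ls(2) by (auto simp: facets_def link_def)
  have "inj_on (insert v) (set Ls)" using vL by (intro inj_onI) (metis insert_ident)
  then have "distinct (map (insert v) Ls)" using Ls(1) by (auto simp: distinct_map)
  moreover have "facets \<Delta> = insert v ` facets (link v \<Delta>)"
  proof (intro set_eqI iffI)
    fix F assume F: "F \<in> facets \<Delta>"
    then have v: "insert v F = F" using cone unfolding facets_def by blast
    have "F - {v} \<in> facets (link v \<Delta>)"
      unfolding facets_def link_def
    proof (intro CollectI conjI ballI impI)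
      show "v \<notin> F - {v}" by simp
      show "insert v (F - {v}) \<in> \<Delta>" using F v by (simp add: facets_def)
      fix E assume E: "E \<in> {A. v \<notin> A \<and> insert v A \<in> \<Delta>}" "F - {v} \<subseteq> E"
      then have "insert v E \<in> \<Delta>" "F \<subseteq> insert v E" by auto
      then have "insert v E = F" using F by (simp add: facets_def)
      then show "E = F - {v}" using E by auto
    qed
    then have "insert v (F - {v}) \<in> insert v ` facets (link v \<Delta>)" by (rule imageI)
    then show "F \<in> insert v ` facets (link v \<Delta>)" using v by simp
  next
    fix F assume "F \<in> insert v ` facets (link v \<Delta>)"
    then obtain L where L: "F = insert v L" "L \<in> facets (link v \<Delta>)" by auto
    have "E = F" if "E \<in> \<Delta>" "F \<subseteq> E" for E
    proof -
      have "v \<in> E" using that L(1) by auto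
      then have "E - {v} \<in> link v \<Delta>" "L \<subseteq> E - {v}"
        using that L unfolding facets_def link_def by (auto simp: insert_absorb)
      then have "E - {v} = L" using L(2) unfolding facets_def by auto
      then show ?thesis using L(1) \<open>v \<in> E\<close> by auto
    qed
    then show "F \<in> facets \<Delta>" using L unfolding facets_def link_def by auto
  qed
  then have "set (map (insert v) Ls) = facets \<Delta>" using Ls(2) by simp
  moreover have "shelling (map (insert v) Ls)" by (rule shelling_map_insert[OF Ls(3) vL])
  ultimately show ?thesis unfolding has_shelling_def by blast
qed

section \<open>Components of induced subgraphs\<close>

text \<open>For \<open>u \<notin> A\<close> this is \<open>{u}\<close>.\<close>
definition ccomp :: "('a \<Rightarrow> 'a \<Rightarrow> bool) \<Rightarrow> 'a set \<Rightarrow> 'a \<Rightarrow> 'a set" where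
  "ccomp adj A u = {v. (\<lambda>x y. x \<in> A \<and> y \<in> A \<and> adj x y)\<^sup>*\<^sup>* u v}"

lemma ccomp_self: "u \<in> ccomp adj A u"
  by (simp add: ccomp_def)

lemma ccomp_step:
  assumes "v \<in> ccomp adj A u" "v \<in> A" "w \<in> A" "adj v w"
  shows "w \<in> ccomp adj A u"
  using assms unfolding ccomp_def by (auto intro: rtranclp.rtrancl_into_rtrancl)

text \<open>Rule induction on paths, in the form by which components are bounded from above
  throughout.\<close>

lemma ccomp_closed:
  assumes "u \<in> T" "\<And>v w. v \<in> T \<Longrightarrow> v \<in> A \<Longrightarrow> w \<in> A \<Longrightarrow> adj v w \<Longrightarrow> w \<in> T"
  shows "ccomp adj A u \<subseteq> T"
proof
  fix v assume "v \<in> ccomp adj A u"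
  then have "(\<lambda>x y. x \<in> A \<and> y \<in> A \<and> adj x y)\<^sup>*\<^sup>* u v" by (simp add: ccomp_def)
  then show "v \<in> T" using assms by (induction rule: rtranclp_induct) auto
qed

lemma ccomp_subset: "u \<in> A \<Longrightarrow> ccomp adj A u \<subseteq> A"
  by (rule ccomp_closed) auto

lemma finite_ccomp: "finite A \<Longrightarrow> finite (ccomp adj A u)"
  by (rule finite_subset[OF ccomp_closed[of u "insert u A"]]) auto

lemma ccomp_mono: "A \<subseteq> B \<Longrightarrow> ccomp adj A u \<subseteq> ccomp adj B u"
  by (rule ccomp_closed) (auto intro: ccomp_self ccomp_step)

lemma ccomp_trans:
  assumes "v \<in> ccomp adj A u"
  shows "ccomp adj A v \<subseteq> ccomp adj A u"
  using assms by (intro ccomp_closed) (auto intro: ccomp_step)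

lemma ccomp_sym:
  assumes "symp adj" "v \<in> ccomp adj A u"
  shows "u \<in> ccomp adj A v"
proof -
  let ?R = "\<lambda>x y. x \<in> A \<and> y \<in> A \<and> adj x y"
  have "?R\<^sup>*\<^sup>* v u"
    using assms symp_rtranclp[of ?R] unfolding ccomp_def symp_def by auto
  then show ?thesis by (simp add: ccomp_def)
qed

lemma ccomp_eq: "symp adj \<Longrightarrow> v \<in> ccomp adj A u \<Longrightarrow> ccomp adj A v = ccomp adj A u"
  by (rule equalityI) (use ccomp_trans ccomp_sym in fast)+

text \<open>Cut a path from \<open>p\<close> after its last visit to \<open>p\<close>: the rest runs
  inside \<open>Z\<close>.\<close>

lemma ccomp_insert_cases:
  assumes "q \<in> ccomp adj (insert p Z) p"
  shows "q = p \<or> (\<exists>n \<in> Z. adj p n \<and> q \<in> ccomp adj Z n)"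
proof -
  have "ccomp adj (insert p Z) p \<subseteq> {q. q = p \<or> (\<exists>n \<in> Z. adj p n \<and> q \<in> ccomp adj Z n)}"
    by (rule ccomp_closed) (auto intro: ccomp_self ccomp_step)
  then show ?thesis using assms by auto
qed

lemma ccomp_insert_avoid:
  assumes "symp adj" "w \<in> Z" "p \<notin> ccomp adj (insert p Z) w"
  shows "ccomp adj (insert p Z) w \<subseteq> ccomp adj Z w"
proof -
  \<comment> \<open>Membership in the larger component is carried along, so that each next vertex is
    known to differ from \<open>p\<close>.\<close>
  have "ccomp adj (insert p Z) w \<subseteq> ccomp adj Z w \<inter> ccomp adj (insert p Z) w"
  proof (rule ccomp_closed)
    fix v x assume v: "v \<in> ccomp adj Z w \<inter> ccomp adj (insert p Z) w"
      and x: "x \<in> insert p Z" "adj v x" and "v \<in> insert p Z"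
    have "v \<in> Z" using v ccomp_subset[OF assms(2)] by blast
    have "x \<in> ccomp adj (insert p Z) w" using v x \<open>v \<in> insert p Z\<close> by (blast intro: ccomp_step)
    moreover from this have "x \<in> Z" using assms(3) x by auto
    ultimately show "x \<in> ccomp adj Z w \<inter> ccomp adj (insert p Z) w"
      using v x \<open>v \<in> Z\<close> by (blast intro: ccomp_step)
  qed (auto intro: ccomp_self)
  then show ?thesis by auto
qed

section \<open>r-independence and exchange of vertices\<close>

definition r_indep :: "nat \<Rightarrow> ('a \<Rightarrow> 'a \<Rightarrow> bool) \<Rightarrow> 'a set \<Rightarrow> bool" where
  "r_indep r adj A \<longleftrightarrow> (\<forall>u \<in> A. card (ccomp adj A u) \<le> r)"

lemma r_indep_subset:
  assumes "finite A" "r_indep r adj A" "B \<subseteq> A"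
  shows "r_indep r adj B"
  unfolding r_indep_def
proof
  fix u assume "u \<in> B"
  then have u: "u \<in> A" using assms(3) by auto
  have "finite (ccomp adj A u)" using assms(1) by (rule finite_ccomp)
  then have "card (ccomp adj B u) \<le> card (ccomp adj A u)"
    using ccomp_mono[OF assms(3)] by (rule card_mono)
  also have "\<dots> \<le> r" using assms(2) u by (simp add: r_indep_def)
  finally show "card (ccomp adj B u) \<le> r" .
qed

text \<open>Components that avoid \<open>p\<close> do not grow, and every other one is the component
  of \<open>p\<close>.\<close>

lemma r_indep_insert:
  assumes "symp adj" "finite Z" "r_indep r adj Z" "card (ccomp adj (insert p Z) p) \<le> r"
  shows "r_indep r adj (insert p Z)"
  unfolding r_indep_def
proof
  fix w assume w: "w \<in> insert p Z"
  show "card (ccomp adj (insert p Z) w) \<le> r"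
  proof (cases "p \<in> ccomp adj (insert p Z) w")
    case True
    then show ?thesis using ccomp_eq[OF assms(1) True] assms(4) by simp
  next
    case False
    then have "w \<in> Z" using w ccomp_self by fastforce
    have "finite (ccomp adj Z w)" using assms(2) by (rule finite_ccomp)
    then have "card (ccomp adj (insert p Z) w) \<le> card (ccomp adj Z w)"
      using ccomp_insert_avoid[OF assms(1) \<open>w \<in> Z\<close> False] by (rule card_mono)
    also have "\<dots> \<le> r" using assms(3) \<open>w \<in> Z\<close> by (simp add: r_indep_def)
    finally show ?thesis .
  qed
qed

text \<open>All neighbours of \<open>p\<close> lie in the component of \<open>u\<close>. So the
  component of \<open>p\<close> without \<open>p\<close> embeds into that of \<open>u\<close>
  without \<open>u\<close>, and its size is at most \<open>r\<close>.\<close>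

lemma r_indep_exchange:
  assumes "symp adj" "finite Z" "r_indep r adj (insert u Z)" "u \<notin> Z" "p \<notin> Z"
    and nbrs: "\<And>n. n \<in> Z \<Longrightarrow> adj p n \<Longrightarrow> n \<in> ccomp adj (insert u Z) u"
  shows "r_indep r adj (insert p Z)"
proof (rule r_indep_insert)
  let ?C = "ccomp adj (insert u Z) u" and ?P = "ccomp adj (insert p Z) p"
  show "symp adj" "finite Z" by fact+
  show "r_indep r adj Z" using r_indep_subset[OF _ assms(3)] assms(2) by auto
  have fin: "finite ?C" "finite ?P" using assms(2) by (simp_all add: finite_ccomp)
  have "?P - {p} \<subseteq> ?C - {u}"
  proof
    fix q assume "q \<in> ?P - {p}"
    then obtain n where n: "n \<in> Z" "adj p n" "q \<in> ccomp adj Z n"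
      using ccomp_insert_cases[of q adj p Z] by auto
    have "ccomp adj Z n \<subseteq> ccomp adj (insert u Z) n" by (rule ccomp_mono) auto
    also have "\<dots> \<subseteq> ?C" by (rule ccomp_trans[OF nbrs[OF n(1,2)]])
    finally have "q \<in> ?C" using n(3) by auto
    moreover have "q \<in> Z" using n ccomp_subset by fast
    ultimately show "q \<in> ?C - {u}" using assms(4) by auto
  qed
  then have "card (?P - {p}) \<le> card (?C - {u})" using fin(1) by (intro card_mono) auto
  then have "card ?P \<le> card ?C"
    using fin ccomp_self[of p adj] ccomp_self[of u adj]
    by (metis (no_types, lifting) Suc_le_mono card_Suc_Diff1)
  also have "\<dots> \<le> r" using assms(3) by (simp add: r_indep_def)
  finally show "card ?P \<le> r" .
qed

text \<open>The faces that are still possible when \<open>D\<close> is forced in and only \<open>W\<close> is undecided.\<close>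
definition r_ext :: "nat \<Rightarrow> ('a \<Rightarrow> 'a \<Rightarrow> bool) \<Rightarrow> 'a set \<Rightarrow> 'a set \<Rightarrow> 'a set set" where
  "r_ext r adj D W = {A. A \<subseteq> W \<and> r_indep r adj (A \<union> D)}"

lemma deletion_r_ext: "deletion v (r_ext r adj D W) = r_ext r adj D (W - {v})"
  by (auto simp: deletion_def r_ext_def)

lemma link_r_ext:
  "v \<in> W \<Longrightarrow> link v (r_ext r adj D W) = r_ext r adj (insert v D) (W - {v})"
  by (auto simp: link_def r_ext_def)

lemma r_ext_subset:
  assumes "finite W" "finite D" "A \<in> r_ext r adj D W" "B \<subseteq> A"
  shows "B \<in> r_ext r adj D W"
proof -
  have "finite (A \<union> D)" using assms finite_subset by (auto simp: r_ext_def)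
  then have "r_indep r adj (B \<union> D)"
    using r_indep_subset[of "A \<union> D" r adj "B \<union> D"] assms(3,4) by (auto simp: r_ext_def)
  then show ?thesis using assms(3,4) by (auto simp: r_ext_def)
qed

lemma has_shelling_r_ext_shed:
  assumes "finite W" "finite D" "v \<in> W"
    and "has_shelling (r_ext r adj D (W - {v}))" "has_shelling (r_ext r adj (insert v D) (W - {v}))"
    and shed: "\<And>F. F \<in> facets (r_ext r adj D (W - {v})) \<Longrightarrow> \<not> r_indep r adj (insert v (F \<union> D))"
  shows "has_shelling (r_ext r adj D W)"
proof (rule has_shelling_shedding[of _ v])
  show "finite (r_ext r adj D W)"
    using assms(1) by (rule finite_subset[rotated, OF finite_Pow_iff[THEN iffD2]]) (auto simp: r_ext_def)
  show "insert v F \<notin> r_ext r adj D W" if "F \<in> facets (deletion v (r_ext r adj D W))" for F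
  proof
    assume "insert v F \<in> r_ext r adj D W"
    then have "r_indep r adj (insert v (F \<union> D))" by (simp add: r_ext_def)
    then show False using shed that unfolding deletion_r_ext by blast
  qed
  show "has_shelling (deletion v (r_ext r adj D W))" using assms(4) by (simp add: deletion_r_ext)
  show "has_shelling (link v (r_ext r adj D W))" using assms(3,5) by (simp add: link_r_ext)
qed (rule r_ext_subset[OF assms(1,2)])

section \<open>Shedding with simplicial vertices\<close>

definition simplicial_vertex :: "('a \<Rightarrow> 'a \<Rightarrow> bool) \<Rightarrow> 'a \<Rightarrow> bool" where
  "simplicial_vertex adj p \<longleftrightarrow> (\<forall>x y. adj p x \<and> adj p y \<and> x \<noteq> y \<longrightarrow> adj x y)"

text \<open>If \<open>v\<close> fails to be a shedding vertex at the facet \<open>F\<close>, then the component of \<open>v\<close> has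
  absorbed all simplicial vertices next to it: any other one could be exchanged for \<open>v\<close>.\<close>
lemma facet_absorbs_simplicial:
  assumes "symp adj" "finite W" "finite D" "D \<inter> W = {}" "v \<in> W"
    and F: "F \<in> facets (r_ext r adj D (W - {v}))"
    and indep: "r_indep r adj (insert v (F \<union> D))"
    and p: "p \<in> W" "simplicial_vertex adj p"
    and c: "c \<in> ccomp adj (insert v (F \<union> D)) v" "adj p c"
  shows "p \<in> ccomp adj (insert v (F \<union> D)) v"
proof -
  let ?Z = "F \<union> D"
  have FW: "F \<subseteq> W - {v}" using F by (auto simp: facets_def r_ext_def)
  have cZ: "c \<in> insert v ?Z" using c(1) ccomp_subset[of v "insert v ?Z"] by auto
  have sym: "adj c p" "\<And>x y. adj x y \<Longrightarrow> adj y x" using c(2) assms(1) by (auto simp: symp_def)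
  show ?thesis
  proof (cases "p \<in> insert v ?Z")
    case True
    then show ?thesis using ccomp_step[OF c(1) cZ True] sym by auto
  next
    case False
    \<comment> \<open>The neighbours of the simplicial vertex \<open>p\<close> are \<open>c\<close>
      and vertices adjacent to \<open>c\<close>, so \<open>p\<close> may replace \<open>v\<close>.
      Then \<open>p\<close> extends \<open>F\<close> inside the deletion, against
      maximality.\<close>
    have "r_indep r adj (insert p ?Z)"
    proof (rule r_indep_exchange[OF assms(1) _ indep])
      show "finite ?Z" using FW assms(2,3) finite_subset by blast
      show "v \<notin> ?Z" using FW assms(4,5) by auto
      show "p \<notin> ?Z" using False by auto
      fix n assume n: "n \<in> ?Z" "adj p n"
      show "n \<in> ccomp adj (insert v ?Z) v"
      proof (cases "n = c")
        case False
        then have "adj c n" using p(2) c(2) n(2) unfolding simplicial_vertex_def by metis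
        then show ?thesis using ccomp_step[OF c(1) cZ] n(1) by auto
      qed (use c in simp)
    qed
    then have "insert p F \<in> r_ext r adj D (W - {v})"
      using False FW p(1) by (auto simp: r_ext_def)
    then have "insert p F = F" using F by (auto simp: facets_def)
    then show ?thesis using False by auto
  qed
qed

text \<open>Either everything undecided may be added, giving a simplex, or
  \<open>W \<union> D\<close> has a component that is too large. If it avoids \<open>W\<close>,
  there are no faces at all. Otherwise any of its vertices in \<open>W\<close> can be shed, since a
  facet admitting that vertex would absorb the whole component.\<close>

lemma has_shelling_r_ext_simplicial:
  assumes "symp adj" "finite W" "finite D" "D \<inter> W = {}"
    and "\<And>p. p \<in> W \<Longrightarrow> simplicial_vertex adj p"
  shows "has_shelling (r_ext r adj D W)"
  using assms(2-5)
proof (induction "card W" arbitrary: W D)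
  case 0
  then have "r_ext r adj D W = Pow {} \<or> r_ext r adj D W = {}" by (auto simp: r_ext_def)
  then show ?case using has_shelling_Pow has_shelling_empty by metis
next
  case (Suc n)
  show ?case
  proof (cases "r_indep r adj (W \<union> D)")
    case True
    have "r_indep r adj (A \<union> D)" if "A \<subseteq> W" for A
      using that r_indep_subset[OF _ True, of "A \<union> D"] Suc.prems(1,2) by auto
    then have "r_ext r adj D W = Pow W" by (auto simp: r_ext_def)
    then show ?thesis using has_shelling_Pow by metis
  next
    case False
    then obtain u where u: "u \<in> W \<union> D" "card (ccomp adj (W \<union> D) u) > r"
      by (auto simp: r_indep_def not_le)
    show ?thesis
    proof (cases "ccomp adj (W \<union> D) u \<inter> W = {}")
      case True
      then have uD: "u \<in> D" using u(1) ccomp_self by fast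
      \<comment> \<open>The component never enters \<open>W\<close>, so it is already a component of
        \<open>D\<close> and stays inside a component of each \<open>A \<union> D\<close>.\<close>
      have "ccomp adj (W \<union> D) u \<subseteq> ccomp adj D u \<inter> ccomp adj (W \<union> D) u"
      proof (rule ccomp_closed)
        fix v w assume v: "v \<in> ccomp adj D u \<inter> ccomp adj (W \<union> D) u"
          and w: "v \<in> W \<union> D" "w \<in> W \<union> D" "adj v w"
        then have w': "w \<in> ccomp adj (W \<union> D) u" using ccomp_step[of v adj "W \<union> D" u w] by auto
        then have "w \<in> D" "v \<in> D" using v w True by auto
        then show "w \<in> ccomp adj D u \<inter> ccomp adj (W \<union> D) u"
          using w' v w ccomp_step[of v adj D u w] by auto
      qed (auto intro: ccomp_self)
      then have le: "ccomp adj (W \<union> D) u \<subseteq> ccomp adj D u" by auto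
      have "A \<notin> r_ext r adj D W" for A
      proof
        assume A: "A \<in> r_ext r adj D W"
        then have "finite (A \<union> D)" using Suc.prems(1,2) finite_subset by (auto simp: r_ext_def)
        then have "finite (ccomp adj (A \<union> D) u)" by (rule finite_ccomp)
        moreover have "ccomp adj (W \<union> D) u \<subseteq> ccomp adj (A \<union> D) u"
          using le ccomp_mono[of D "A \<union> D" adj u] by auto
        ultimately have "card (ccomp adj (W \<union> D) u) \<le> card (ccomp adj (A \<union> D) u)"
          by (rule card_mono)
        also have "\<dots> \<le> r" using A uD by (auto simp: r_ext_def r_indep_def)
        finally show False using u(2) by simp
      qed
      then have "r_ext r adj D W = {}" by auto
      then show ?thesis using has_shelling_empty by metis
    next
      case False
      then obtain v where v: "v \<in> W" "v \<in> ccomp adj (W \<union> D) u" by auto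
      have big: "card (ccomp adj (W \<union> D) v) > r" using ccomp_eq[OF assms(1) v(2)] u(2) by simp
      show ?thesis
      proof (rule has_shelling_r_ext_shed)
        show "finite W" "finite D" "v \<in> W" by fact+
        have n: "n = card (W - {v})" using Suc.hyps(2) v(1) Suc.prems(1) by simp
        show "has_shelling (r_ext r adj D (W - {v}))"
          using Suc.prems by (intro Suc.hyps(1)[OF n]) auto
        show "has_shelling (r_ext r adj (insert v D) (W - {v}))"
          using Suc.prems by (intro Suc.hyps(1)[OF n]) auto
        fix F assume F: "F \<in> facets (r_ext r adj D (W - {v}))"
        show "\<not> r_indep r adj (insert v (F \<union> D))"
        proof
          assume indep: "r_indep r adj (insert v (F \<union> D))"
          let ?C = "ccomp adj (insert v (F \<union> D)) v"
          have FW: "F \<subseteq> W - {v}" using F by (auto simp: facets_def r_ext_def)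
          \<comment> \<open>The next vertex on a path is present anyway if it lies in
            \<open>D\<close>, and is absorbed as a simplicial vertex if it lies in
            \<open>W\<close>.\<close>
          have "ccomp adj (W \<union> D) v \<subseteq> ?C"
          proof (rule ccomp_closed)
            fix c w assume c: "c \<in> ?C" and w: "w \<in> W \<union> D" "adj c w"
            have w': "adj w c" using w(2) assms(1) by (auto simp: symp_def)
            show "w \<in> ?C"
            proof (cases "w \<in> W")
              case True
              then show ?thesis
                using facet_absorbs_simplicial[OF assms(1) Suc.prems(1-3) v(1) F indep True _ c w']
                  Suc.prems(4) by auto
            next
              case False
              then show ?thesis
                using w c ccomp_step[OF c _ _ w(2)] ccomp_subset[of v "insert v (F \<union> D)"] by auto
            qed
          qed (rule ccomp_self)
          moreover have "finite F" using FW Suc.prems(1) finite_subset by blast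
          then have "finite ?C" using Suc.prems(2) by (intro finite_ccomp) auto
          ultimately have "card (ccomp adj (W \<union> D) v) \<le> card ?C" by (intro card_mono)
          also have "\<dots> \<le> r" using indep by (simp add: r_indep_def)
          finally show False using big by simp
        qed
      qed
    qed
  qed
qed

section \<open>Graphs with star-cliques attached to all vertices\<close>

text \<open>Here \<open>S\<close> stands for the vertices of H and \<open>V x\<close> for those of
  the star-clique at \<open>x\<close>. Chordality enters only as Dirac's theorem for the induced
  subgraphs of H, in \<open>simplicial_S\<close>.\<close>

locale star_clique_graph =
  fixes adj :: "'a \<Rightarrow> 'a \<Rightarrow> bool" and S :: "'a set" and V :: "'a \<Rightarrow> 'a set" and t r :: nat
  assumes symp: "symp adj"
    and finite_S: "finite S"
    and finite_V: "x \<in> S \<Longrightarrow> finite (V x)"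
    and center: "x \<in> S \<Longrightarrow> V x \<inter> S = {x}"
    and disjoint: "x \<in> S \<Longrightarrow> y \<in> S \<Longrightarrow> x \<noteq> y \<Longrightarrow> V x \<inter> V y = {}"
    and card_V: "x \<in> S \<Longrightarrow> t + 1 \<le> card (V x)"
    and r_le: "r \<le> 2 * t + 1"
    and outer: "x \<in> S \<Longrightarrow> p \<in> V x - {x} \<Longrightarrow> adj p x \<and> simplicial_vertex adj p \<and> {q. adj p q} \<subseteq> V x"
    and nbrs_center: "x \<in> S \<Longrightarrow> {q. adj x q} \<subseteq> V x \<union> S"
    and simplicial_S: "U \<subseteq> S \<Longrightarrow> U \<noteq> {} \<Longrightarrow>
      \<exists>x \<in> U. \<forall>y \<in> U. \<forall>z \<in> U. adj x y \<and> adj x z \<and> y \<noteq> z \<longrightarrow> adj y z"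
begin

definition outers :: "'a set" where
  "outers = (\<Union>x \<in> S. V x - {x})"

lemma center_in: "x \<in> S \<Longrightarrow> x \<in> V x"
  using center by blast

lemma outers_not_S: "p \<in> outers \<Longrightarrow> p \<notin> S"
  using center unfolding outers_def by blast

lemma finite_outers: "finite outers"
  using finite_S finite_V by (auto simp: outers_def)

text \<open>The vertices of \<open>V d\<close> other than \<open>d\<close> are undecided, simplicial
  and adjacent to \<open>d\<close>, so \<open>facet_absorbs_simplicial\<close> applies with
  \<open>c = d\<close>.\<close>

lemma component_contains_star_clique:
  assumes U: "U \<subseteq> S" and D: "D \<subseteq> S - U" and u: "u \<in> U"
    and F: "F \<in> facets (r_ext r adj D (U \<union> outers - {u}))"
    and indep: "r_indep r adj (insert u (F \<union> D))"
    and d: "d \<in> S" "d \<in> ccomp adj (insert u (F \<union> D)) u"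
  shows "V d \<subseteq> ccomp adj (insert u (F \<union> D)) u"
proof
  fix p assume p: "p \<in> V d"
  show "p \<in> ccomp adj (insert u (F \<union> D)) u"
  proof (cases "p = d")
    case False
    have "D \<inter> (U \<union> outers) = {}" using D outers_not_S by blast
    moreover have "p \<in> U \<union> outers" using p False d(1) by (auto simp: outers_def)
    moreover have "adj p d" "simplicial_vertex adj p" using outer[OF d(1)] p False by auto
    moreover have "finite (U \<union> outers)" "finite D"
      using U D finite_S finite_outers finite_subset by (blast, blast)
    ultimately show ?thesis
      using facet_absorbs_simplicial[OF symp _ _ _ _ F indep] u d(2) by blast
  qed (use d in simp)
qed

text \<open>Two centers would bring in two disjoint star-cliques, at least 2t + 2 vertices. This is
  where the bound \<open>r_le\<close> enters.\<close>

lemma component_unique_center: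
  assumes U: "U \<subseteq> S" and D: "D \<subseteq> S - U" and u: "u \<in> U"
    and F: "F \<in> facets (r_ext r adj D (U \<union> outers - {u}))"
    and indep: "r_indep r adj (insert u (F \<union> D))"
    and d: "d \<in> S" "d \<in> ccomp adj (insert u (F \<union> D)) u"
    and e: "e \<in> S" "e \<in> ccomp adj (insert u (F \<union> D)) u"
  shows "d = e"
proof (rule ccontr)
  assume "d \<noteq> e"
  let ?C = "ccomp adj (insert u (F \<union> D)) u"
  have "F \<subseteq> U \<union> outers" using F by (auto simp: facets_def r_ext_def)
  then have "F \<union> D \<subseteq> S \<union> outers" using U D by auto
  then have "finite (insert u (F \<union> D))"
    using finite_S finite_outers finite_subset by blast
  then have "finite ?C" by (rule finite_ccomp)
  moreover have "V d \<union> V e \<subseteq> ?C"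
    using component_contains_star_clique[OF U D u F indep] d e by blast
  ultimately have "card (V d \<union> V e) \<le> card ?C" by (rule card_mono)
  moreover have "card (V d \<union> V e) = card (V d) + card (V e)"
    using disjoint[OF d(1) e(1) \<open>d \<noteq> e\<close>] finite_V d(1) e(1) by (simp add: card_Un_disjoint)
  moreover have "card ?C \<le> r" using indep by (simp add: r_indep_def)
  ultimately show False using card_V[OF d(1)] card_V[OF e(1)] r_le by linarith
qed

lemma shed_adjacent_forced:
  assumes U: "U \<subseteq> S" and D: "D \<subseteq> S - U" and u: "u \<in> U"
    and F: "F \<in> facets (r_ext r adj D (U \<union> outers - {u}))"
    and d: "d \<in> D" "adj u d"
  shows "\<not> r_indep r adj (insert u (F \<union> D))"
proof
  assume indep: "r_indep r adj (insert u (F \<union> D))"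
  have "d \<in> ccomp adj (insert u (F \<union> D)) u"
    using d by (intro ccomp_step[OF ccomp_self]) auto
  then have "d = u"
    using component_unique_center[OF U D u F indep, of d u] ccomp_self[of u] d(1) u U D by blast
  then show False using d(1) u D by auto
qed

lemma shed_large:
  assumes U: "U \<subseteq> S" and D: "D \<subseteq> S - U" and u: "u \<in> U"
    and F: "F \<in> facets (r_ext r adj D (U \<union> outers - {u}))"
    and large: "card (V u) > r"
  shows "\<not> r_indep r adj (insert u (F \<union> D))"
proof
  assume indep: "r_indep r adj (insert u (F \<union> D))"
  let ?C = "ccomp adj (insert u (F \<union> D)) u"
  have "F \<subseteq> U \<union> outers" using F by (auto simp: facets_def r_ext_def)
  then have "F \<union> D \<subseteq> S \<union> outers" using U D by auto
  then have "finite (insert u (F \<union> D))"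
    using finite_S finite_outers finite_subset by blast
  then have "finite ?C" by (rule finite_ccomp)
  moreover have "V u \<subseteq> ?C"
    using U u by (intro component_contains_star_clique[OF U D u F indep] ccomp_self) auto
  ultimately have "card (V u) \<le> card ?C" by (rule card_mono)
  also have "\<dots> \<le> r" using indep by (simp add: r_indep_def)
  finally show False using large by simp
qed

text \<open>A path can leave \<open>V x\<close> only from \<open>x\<close> towards another center,
  as outer vertices have all their neighbours in \<open>V x\<close>.\<close>

lemma card_ccomp_isolated_center:
  assumes x: "x \<in> S" and Z: "Z \<subseteq> S \<union> outers" "\<And>n. n \<in> Z \<inter> S \<Longrightarrow> \<not> adj x n"
    and small: "card (V x) \<le> r"
  shows "card (ccomp adj (insert x Z) x) \<le> r"
proof -
  have "ccomp adj (insert x Z) x \<subseteq> V x"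
  proof (rule ccomp_closed)
    fix v w assume v: "v \<in> V x" and w: "w \<in> insert x Z" "adj v w"
    show "w \<in> V x"
    proof (cases "v = x")
      case True
      then show ?thesis using w nbrs_center[OF x] Z(2)[of w] center_in[OF x] by blast
    next
      case False
      then show ?thesis using outer[OF x, of v] v w by auto
    qed
  qed (use x center_in in auto)
  then have "card (ccomp adj (insert x Z) x) \<le> card (V x)"
    using finite_V[OF x] by (rule card_mono[rotated])
  then show ?thesis using small by simp
qed

text \<open>If \<open>y\<close> could be added to \<open>F\<close>, no undecided neighbour of
  \<open>y\<close> would be in \<open>F\<close>, being a second center. As \<open>x\<close> is
  simplicial, this rules out \<open>x\<close> and its other neighbours, so \<open>x\<close> sees no
  center in \<open>F \<union> D\<close> and could be added to \<open>F\<close>, against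
  maximality.\<close>

lemma shed_neighbour_of_simplicial:
  assumes U: "U \<subseteq> S" and D: "D \<subseteq> S - U" and y: "y \<in> U"
    and F: "F \<in> facets (r_ext r adj D (U \<union> outers - {y}))"
    and x: "x \<in> U" "x \<noteq> y" "adj x y" "card (V x) \<le> r"
    and simplicial: "\<And>z. z \<in> U \<Longrightarrow> adj x z \<Longrightarrow> z \<noteq> y \<Longrightarrow> adj y z"
    and free: "\<And>d. d \<in> D \<Longrightarrow> \<not> adj x d"
  shows "\<not> r_indep r adj (insert y (F \<union> D))"
proof
  let ?Z = "F \<union> D"
  assume indep: "r_indep r adj (insert y ?Z)"
  have FW: "F \<subseteq> U \<union> outers - {y}" and Fi: "r_indep r adj ?Z"
    using F by (auto simp: facets_def r_ext_def)
  have unique: "z = y" if "z \<in> U" "z \<in> insert y ?Z" "adj y z" for z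
  proof -
    have "z \<in> ccomp adj (insert y ?Z) y"
      using that by (intro ccomp_step[OF ccomp_self]) auto
    then show ?thesis
      using component_unique_center[OF U D y F indep, of z y] that(1) y U ccomp_self[of y] by blast
  qed
  have "x \<notin> ?Z"
    using unique[of x] x D symp by (auto simp: symp_def)
  have isolated: "\<not> adj x n" if "n \<in> ?Z \<inter> S" for n
  proof
    assume n: "adj x n"
    then have "n \<in> F" "n \<in> S" using that free by auto
    then have "n \<in> U" "n \<noteq> y" using FW outers_not_S by auto
    then have "adj y n" using simplicial n by blast
    then show False using unique[OF \<open>n \<in> U\<close>] \<open>n \<in> F\<close> \<open>n \<noteq> y\<close> by blast
  qed
  have Zsub: "?Z \<subseteq> S \<union> outers" using FW U D by auto
  have "card (ccomp adj (insert x ?Z) x) \<le> r"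
    by (rule card_ccomp_isolated_center[OF subsetD[OF U x(1)] Zsub isolated x(4)])
  moreover have "finite ?Z" using Zsub finite_S finite_outers finite_subset by blast
  ultimately have "r_indep r adj (insert x ?Z)" by (intro r_indep_insert[OF symp _ Fi])
  then have "insert x F \<in> r_ext r adj D (U \<union> outers - {y})"
    using FW x by (auto simp: r_ext_def)
  then have "insert x F = F" using F by (auto simp: facets_def)
  then show False using \<open>x \<notin> ?Z\<close> by auto
qed

text \<open>Induction on the number of undecided centers: deletion and link at any of them have one
  fewer. When none is left, all undecided vertices are simplicial.\<close>

lemma has_shelling_extensions:
  assumes "U \<subseteq> S" "D \<subseteq> S - U"
  shows "has_shelling (r_ext r adj D (U \<union> outers))"
  using assms
proof (induction "card U" arbitrary: U D)
  case 0
  then have "U = {}" using finite_S finite_subset by fastforce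
  moreover have "has_shelling (r_ext r adj D outers)"
  proof (rule has_shelling_r_ext_simplicial[OF symp finite_outers])
    show "finite D" using 0 finite_S finite_subset by blast
    show "D \<inter> outers = {}" using 0 outers_not_S by blast
    show "simplicial_vertex adj p" if "p \<in> outers" for p
      using that outer by (auto simp: outers_def)
  qed
  ultimately show ?case by simp
next
  case (Suc n)
  have fin: "finite (U \<union> outers)" "finite D"
    using Suc.prems finite_S finite_outers finite_subset by (blast, blast)
  have del: "has_shelling (r_ext r adj D (U \<union> outers - {v}))"
    and lnk: "has_shelling (r_ext r adj (insert v D) (U \<union> outers - {v}))" if "v \<in> U" for v
  proof -
    have eq: "U \<union> outers - {v} = (U - {v}) \<union> outers"
      using that Suc.prems(1) outers_not_S by auto
    have n: "n = card (U - {v})"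
      using Suc.hyps(2) that fin by simp
    show "has_shelling (r_ext r adj D (U \<union> outers - {v}))"
      unfolding eq using Suc.prems by (intro Suc.hyps(1)[OF n]) auto
    show "has_shelling (r_ext r adj (insert v D) (U \<union> outers - {v}))"
      unfolding eq using Suc.prems that by (intro Suc.hyps(1)[OF n]) auto
  qed
  have shed: ?case if "v \<in> U" "\<And>F. F \<in> facets (r_ext r adj D (U \<union> outers - {v})) \<Longrightarrow>
      \<not> r_indep r adj (insert v (F \<union> D))" for v
    using that by (intro has_shelling_r_ext_shed[OF fin _ del lnk]) auto
  show ?case
  proof (cases "\<exists>u \<in> U. \<exists>d \<in> D. adj u d")
    case True
    then obtain u d where ud: "u \<in> U" "d \<in> D" "adj u d" by auto
    show ?thesis
      by (rule shed[OF ud(1)], rule shed_adjacent_forced[OF Suc.prems ud(1) _ ud(2,3)])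
  next
    case free: False
    have "U \<noteq> {}" using Suc.hyps(2) by auto
    then obtain x where x: "x \<in> U"
      and simplicial: "\<And>y z. y \<in> U \<Longrightarrow> z \<in> U \<Longrightarrow> adj x y \<Longrightarrow> adj x z \<Longrightarrow> y \<noteq> z \<Longrightarrow> adj y z"
      using simplicial_S[OF Suc.prems(1)] by blast
    \<comment> \<open>In these cases one sheds \<open>x\<close> itself, sheds its neighbour
      \<open>y\<close>, or treats \<open>x\<close> as a cone point.\<close>
    consider "card (V x) > r" | y where "card (V x) \<le> r" "y \<in> U" "y \<noteq> x" "adj x y"
      | "card (V x) \<le> r" "\<And>y. y \<in> U \<Longrightarrow> y \<noteq> x \<Longrightarrow> \<not> adj x y"
      by fastforce
    then show ?thesis
    proof cases
      case 1
      then show ?thesis by (intro shed[OF x] shed_large[OF Suc.prems x])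
    next
      case (2 y)
      show ?thesis
      proof (rule shed[OF 2(2)])
        fix F assume F: "F \<in> facets (r_ext r adj D (U \<union> outers - {y}))"
        show "\<not> r_indep r adj (insert y (F \<union> D))"
          by (rule shed_neighbour_of_simplicial[OF Suc.prems 2(2) F x 2(3)[symmetric] 2(4) 2(1)])
            (use simplicial 2 free x in blast)+
      qed
    next
      case 3
      show ?thesis
      proof (rule has_shelling_cone)
        fix A assume A: "A \<in> r_ext r adj D (U \<union> outers)"
        let ?Z = "A \<union> D - {x}"
        have Z: "insert x ?Z = insert x A \<union> D" by auto
        have AW: "A \<subseteq> U \<union> outers" "r_indep r adj (A \<union> D)" using A by (auto simp: r_ext_def)
        then have "finite (A \<union> D)" using fin finite_subset by blast
        then have "r_indep r adj ?Z" using AW(2) by (rule r_indep_subset) auto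
        \<comment> \<open>No other center, forced or undecided, is adjacent to \<open>x\<close>, so
          its component stays within \<open>V x\<close>.\<close>
        moreover have "card (ccomp adj (insert x ?Z) x) \<le> r"
        proof (rule card_ccomp_isolated_center)
          show "x \<in> S" using x Suc.prems by auto
          show "?Z \<subseteq> S \<union> outers" using AW Suc.prems by auto
          show "\<not> adj x n" if "n \<in> ?Z \<inter> S" for n
          proof -
            have "n \<in> D \<or> n \<in> U" "n \<noteq> x" using that AW(1) outers_not_S by auto
            then show ?thesis using free 3(2) x by auto
          qed
        qed (rule 3(1))
        ultimately have "r_indep r adj (insert x ?Z)"
          using \<open>finite (A \<union> D)\<close> by (intro r_indep_insert[OF symp]) auto
        then show "insert x A \<in> r_ext r adj D (U \<union> outers)"
          using AW(1) x unfolding Z by (auto simp: r_ext_def)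
      next
        show "has_shelling (link x (r_ext r adj D (U \<union> outers)))"
          using x lnk[OF x] by (simp add: link_r_ext)
      qed (rule r_ext_subset[OF fin])
    qed
  qed
qed

end

section \<open>Simplicial vertices of chordal graphs\<close>

text \<open>The form of chordality that the proof of Dirac's theorem needs: if \<open>a\<close> and \<open>b\<close> were not
  adjacent, then \<open>v\<close> and a shortest path from \<open>a\<close> to \<open>b\<close> through \<open>M\<close> would form a chordless cycle of
  length at least 4.\<close>
definition hole_free :: "('a \<Rightarrow> 'a \<Rightarrow> bool) \<Rightarrow> bool" where
  "hole_free adj \<longleftrightarrow> (\<forall>v a b M c d. adj v a \<and> adj v b \<and> a \<noteq> b \<and> (\<forall>m \<in> M. m \<noteq> v \<and> \<not> adj v m) \<and>
     c \<in> M \<and> adj a c \<and> d \<in> ccomp adj M c \<and> adj d b \<longrightarrow> adj a b)"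

text \<open>The relative notion serves the centers, which are simplicial only inside a part of H;
  outer vertices are simplicial in all of G.\<close>

definition simplicial_in :: "('a \<Rightarrow> 'a \<Rightarrow> bool) \<Rightarrow> 'a set \<Rightarrow> 'a \<Rightarrow> bool" where
  "simplicial_in adj U x \<longleftrightarrow> (\<forall>y \<in> U. \<forall>z \<in> U. adj x y \<and> adj x z \<and> y \<noteq> z \<longrightarrow> adj y z)"

text \<open>Dirac's theorem, relative to a vertex \<open>v\<close> that is not adjacent to all others.\<close>
lemma simplicial_in_non_neighbour:
  assumes sym: "symp adj" and hole: "hole_free adj"
    and "finite U" "v \<in> U" "w \<in> U" "w \<noteq> v" "\<not> adj v w"
  shows "\<exists>x \<in> U. x \<noteq> v \<and> \<not> adj v x \<and> simplicial_in adj U x"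
  using assms(3-)
proof (induction "card U" arbitrary: U v w rule: less_induct)
  case less
  have sym': "adj y x" if "adj x y" for x y using that sym by (auto simp: symp_def)
  \<comment> \<open>\<open>M\<close> consists of the non-neighbours of \<open>v\<close>,
    \<open>K\<close> is a component of it, and \<open>N\<close> is the boundary of \<open>K\<close>,
    which separates \<open>K\<close> from \<open>v\<close>.\<close>
  define M where "M = {u \<in> U. u \<noteq> v \<and> \<not> adj v u}"
  define K where "K = ccomp adj M w"
  define N where "N = {s \<in> U. \<exists>c \<in> K. adj s c} - K"
  have wM: "w \<in> M" using less.prems by (auto simp: M_def)
  have KM: "K \<subseteq> M" unfolding K_def by (rule ccomp_subset[OF wM])
  have wK: "w \<in> K" by (simp add: K_def ccomp_self)
  have vN: "adj v s" if s: "s \<in> N" for s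
  proof (rule ccontr)
    assume n: "\<not> adj v s"
    obtain c where c: "c \<in> K" "adj s c" "s \<in> U" "s \<notin> K" using s by (auto simp: N_def)
    then have "s \<noteq> v" using KM by (auto simp: M_def)
    then have "s \<in> M" using c n by (auto simp: M_def)
    then have "s \<in> K" using ccomp_step[of c adj M w s] c KM sym' unfolding K_def by auto
    then show False using c by auto
  qed
  \<comment> \<open>Two boundary vertices are neighbours of \<open>v\<close> joined by a path
    through \<open>K\<close>, the situation of \<open>hole_free\<close>.\<close>
  have clique: "adj s s'" if s: "s \<in> N" "s' \<in> N" "s \<noteq> s'" for s s'
  proof -
    obtain c d where cd: "c \<in> K" "adj s c" "d \<in> K" "adj s' d" using s by (auto simp: N_def)
    have "d \<in> ccomp adj M c" using cd ccomp_eq[OF sym, of c M w] unfolding K_def by auto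
    moreover have "\<forall>m \<in> M. m \<noteq> v \<and> \<not> adj v m" by (auto simp: M_def)
    moreover have "c \<in> M" using cd KM by auto
    ultimately show ?thesis
      using hole vN[OF s(1)] vN[OF s(2)] s(3) cd(2) sym'[OF cd(4)] unfolding hole_free_def by blast
  qed
  let ?U = "K \<union> N"
  \<comment> \<open>The vertex \<open>v\<close> is missing: it is not in \<open>K\<close> and has no
    neighbour there.\<close>
  have sub: "?U \<subset> U" using KM less.prems(2) vN by (auto simp: M_def N_def)
  have IH: "\<exists>x \<in> ?U. x \<noteq> u \<and> \<not> adj u x \<and> simplicial_in adj ?U x"
    if "u \<in> ?U" "u' \<in> ?U" "u' \<noteq> u" "\<not> adj u u'" for u u'
  proof (rule less.hyps[OF _ _ that])
    show "card ?U < card U" using less.prems(1) sub by (rule psubset_card_mono)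
    show "finite ?U" using less.prems(1) sub finite_subset by blast
  qed
  \<comment> \<open>The induction hypothesis is applied at a vertex with a non-neighbour in
    \<open>?U\<close>, preferably one in \<open>N\<close>. The vertex found avoids \<open>N\<close>,
    which is a clique, and in the second case also adjacent to all of \<open>?U\<close>. If there is
    no such vertex, \<open>?U\<close> is complete.\<close>
  have "\<exists>x \<in> K. simplicial_in adj ?U x"
  proof (cases "\<exists>s \<in> N. \<exists>u \<in> ?U. u \<noteq> s \<and> \<not> adj s u")
    case True
    then obtain s u where su: "s \<in> N" "u \<in> ?U" "u \<noteq> s" "\<not> adj s u" by auto
    then obtain x where "x \<in> ?U" "x \<noteq> s" "\<not> adj s x" "simplicial_in adj ?U x"
      using IH[of s u] by blast
    moreover from this have "x \<notin> N" using clique[of s x] su(1) by auto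
    ultimately show ?thesis by auto
  next
    case univ: False
    show ?thesis
    proof (cases "\<exists>c \<in> K. \<exists>u \<in> ?U. u \<noteq> c \<and> \<not> adj c u")
      case True
      then obtain c u where cu: "c \<in> K" "u \<in> ?U" "u \<noteq> c" "\<not> adj c u" by auto
      then obtain x where x: "x \<in> ?U" "x \<noteq> c" "\<not> adj c x" "simplicial_in adj ?U x"
        using IH[of c u] by blast
      have "x \<notin> N"
      proof
        assume "x \<in> N"
        then have "adj x c" using univ cu(1) x(2) by auto
        then show False using x(3) sym' by blast
      qed
      then show ?thesis using x by auto
    next
      case False
      then have "adj y z" if "y \<in> ?U" "z \<in> ?U" "y \<noteq> z" for y z
        using that univ by auto
      then have "simplicial_in adj ?U w" by (simp add: simplicial_in_def)
      then show ?thesis using wK by auto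
    qed
  qed
  then obtain x where x: "x \<in> K" "simplicial_in adj ?U x" by auto
  \<comment> \<open>All neighbours of \<open>K\<close> within \<open>U\<close> lie in
    \<open>K \<union> N\<close>, so being simplicial there suffices.\<close>
  have nbr: "y \<in> ?U" if "y \<in> U" "adj x y" for y
    using that x(1) sym'[of x y] by (auto simp: N_def)
  have "simplicial_in adj U x"
    unfolding simplicial_in_def
  proof (intro ballI impI)
    fix y z assume "y \<in> U" "z \<in> U" "adj x y \<and> adj x z \<and> y \<noteq> z"
    then show "adj y z" using x(2) nbr[of y] nbr[of z] unfolding simplicial_in_def by blast
  qed
  then show ?case using x(1) KM by (auto simp: M_def)
qed

lemma ex_simplicial_in:
  assumes "symp adj" "hole_free adj" "finite U" "U \<noteq> {}"
  shows "\<exists>x \<in> U. simplicial_in adj U x"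
proof (cases "\<exists>v \<in> U. \<exists>w \<in> U. w \<noteq> v \<and> \<not> adj v w")
  case True
  then show ?thesis using simplicial_in_non_neighbour[OF assms(1-3)] by blast
next
  case False
  then have "simplicial_in adj U x" for x by (auto simp: simplicial_in_def)
  then show ?thesis using assms(4) by blast
qed

section \<open>From reachability to induced paths\<close>

lemma ccomp_walk:
  assumes "d \<in> ccomp adj M c" "c \<in> M" "adj a c"
  shows "\<exists>q. set q \<subseteq> M \<and> successively adj (a # q) \<and> q \<noteq> [] \<and> last q = d"
proof -
  have "ccomp adj M c \<subseteq> {d. \<exists>q. set q \<subseteq> M \<and> successively adj (a # q) \<and> q \<noteq> [] \<and> last q = d}"
  proof (rule ccomp_closed)
    show "c \<in> {d. \<exists>q. set q \<subseteq> M \<and> successively adj (a # q) \<and> q \<noteq> [] \<and> last q = d}"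
      using assms by (auto intro!: exI[of _ "[c]"])
    fix v w
    assume "v \<in> {d. \<exists>q. set q \<subseteq> M \<and> successively adj (a # q) \<and> q \<noteq> [] \<and> last q = d}"
      and w: "v \<in> M" "w \<in> M" "adj v w"
    then obtain q where q: "set q \<subseteq> M" "successively adj (a # q)" "q \<noteq> []" "last q = v" by auto
    then have "successively adj ((a # q) @ [w])" using w(3) by (subst successively_append_iff) auto
    then show "w \<in> {d. \<exists>q. set q \<subseteq> M \<and> successively adj (a # q) \<and> q \<noteq> [] \<and> last q = d}"
      using q(1) w(2) by (auto intro!: exI[of _ "q @ [w]"])
  qed
  then show ?thesis using assms(1) by auto
qed

lemma successively_shortcut_eq:
  "successively P (xs @ y # ys @ y # zs) \<Longrightarrow> successively P (xs @ y # zs)"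
  by (auto simp: successively_append_iff successively_Cons)

lemma successively_shortcut:
  "successively P (xs @ u # ys @ w # zs) \<Longrightarrow> P u w \<Longrightarrow> successively P (xs @ u # w # zs)"
  by (auto simp: successively_append_iff successively_Cons)

text \<open>A shortest walk from \<open>a\<close> to \<open>b\<close> is an induced path.\<close>
lemma shortest_walk:
  assumes "set q0 \<subseteq> M" "successively adj (a # q0 @ [b])" "a \<notin> M" "b \<notin> M" "a \<noteq> b" "\<not> adj a b"
  obtains q where "set q \<subseteq> M" "successively adj (a # q @ [b])" "q \<noteq> []" "distinct (a # q @ [b])"
    "\<And>xs u ys w zs. a # q @ [b] = xs @ u # ys @ w # zs \<Longrightarrow> adj u w \<Longrightarrow> ys = []"
proof -
  let ?P = "\<lambda>q. set q \<subseteq> M \<and> successively adj (a # q @ [b])"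
  obtain q where q: "?P q" and min: "\<And>q'. ?P q' \<Longrightarrow> length q \<le> length q'"
    using ex_has_least_nat[of ?P q0 length] assms(1,2) by blast
  have "q \<noteq> []" using q assms(6) by auto
  have "distinct q"
  proof (rule ccontr)
    assume "\<not> distinct q"
    then obtain xs ys zs y where eq: "q = xs @ [y] @ ys @ [y] @ zs"
      using not_distinct_decomp by blast
    have "?P (xs @ y # zs)"
      using q successively_shortcut_eq[of adj "a # xs" y ys "zs @ [b]"] unfolding eq by auto
    then show False using min[of "xs @ y # zs"] eq by simp
  qed
  then have dist: "distinct (a # q @ [b])" using q assms(3-5) by auto
  have "ys = []" if eq: "a # q @ [b] = xs @ u # ys @ w # zs" and adj: "adj u w" for xs u ys w zs
  proof -
    have succ: "successively adj (xs @ u # w # zs)"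
      using q adj unfolding eq by (blast intro: successively_shortcut)
    \<comment> \<open>The shortened walk still runs from \<open>a\<close> to \<open>b\<close>. It
      could lose an end only if \<open>u = a\<close> and \<open>w = b\<close>, which are not
      adjacent.\<close>
    obtain q' where q': "xs @ u # w # zs = a # q' @ [b]"
    proof (cases xs)
      case xs: Nil
      show ?thesis
      proof (cases zs rule: rev_cases)
        case Nil
        then have "u = a" "w = b" using eq xs by (auto simp: append_eq_append_conv2 Cons_eq_append_conv)
        then show ?thesis using assms(6) adj by auto
      next
        case (snoc zs' z)
        then have "z = b" "u = a" using eq xs by auto
        then show ?thesis using that[of "w # zs'"] xs snoc by auto
      qed
    next
      case (Cons x xs')
      show ?thesis
      proof (cases zs rule: rev_cases)
        case Nil
        have "last (a # q @ [b]) = w" unfolding eq Nil by simp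
        then have "w = b" by simp
        then show ?thesis using that[of "xs' @ [u]"] eq Cons Nil by auto
      next
        case (snoc zs' z)
        have "last (a # q @ [b]) = z" unfolding eq snoc by simp
        then have "z = b" by simp
        then show ?thesis using that[of "xs' @ u # w # zs'"] eq Cons snoc by auto
      qed
    qed
    have "set (xs @ u # w # zs) \<subseteq> set (a # q @ [b])" unfolding eq by auto
    then have "set (a # q' @ [b]) \<subseteq> set (a # q @ [b])" unfolding q' .
    \<comment> \<open>Distinctness keeps \<open>a\<close> and \<open>b\<close> out of
      \<open>q'\<close>, so \<open>q'\<close> stays in \<open>M\<close> and competes with the
      minimal \<open>q\<close>.\<close>
    moreover have "distinct (xs @ u # w # zs)" using dist unfolding eq by auto
    then have "distinct (a # q' @ [b])" unfolding q' .
    ultimately have "set q' \<subseteq> M" using q by auto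
    then have "length q \<le> length q'" using min[of q'] succ q' by simp
    moreover have "length (a # q @ [b]) = length (a # q' @ [b]) + length ys"
      unfolding q'[symmetric] eq by simp
    ultimately show "ys = []" by simp
  qed
  then show ?thesis using that q \<open>q \<noteq> []\<close> dist by blast
qed

section \<open>Digraphs\<close>

abbreviation padj :: "'a pair_pre_digraph \<Rightarrow> 'a \<Rightarrow> 'a \<Rightarrow> bool" where
  "padj G u v \<equiv> (u, v) \<in> parcs G"

lemma (in pair_graph) symp_padj: "symp (padj G)"
  by (auto simp: symp_def intro: arcs_symmetric)

lemma (in pair_graph) padj_irrefl: "\<not> padj G u u"
  using pair_no_loops[of "(u, u)"] by auto

lemma (in pair_graph) awalk_vwalk_arcs:
  assumes "successively (padj G) (x # xs)" "x \<in> pverts G"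
  shows "awalk x (vwalk_arcs (x # xs)) (last (x # xs)) \<and> pawalk_verts x (vwalk_arcs (x # xs)) = x # xs"
  using assms
proof (induction xs arbitrary: x)
  case Nil
  then show ?case by (simp add: awalk_Nil_iff)
next
  case (Cons y ys)
  then have xy: "(x, y) \<in> parcs G" and "successively (padj G) (y # ys)"
    by (simp_all add: successively_Cons)
  moreover have "y \<in> pverts G" using xy by (rule in_arcsD2)
  ultimately have "awalk y (vwalk_arcs (y # ys)) (last (y # ys)) \<and>
      pawalk_verts y (vwalk_arcs (y # ys)) = y # ys"
    using Cons.IH by blast
  then show ?case using xy by (simp add: awalk_Cons_iff)
qed

text \<open>Chords are sought among the tails of arcs, which omit the last vertex; in a closed walk
  it recurs as the first.\<close>

lemma fst_set_vwalk_arcs: "fst ` set (vwalk_arcs (xs @ [x])) = set xs"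
proof (induction xs)
  case (Cons y ys)
  then show ?case by (cases ys) auto
qed simp

lemma consecutive_in_vwalk_arcs: "(u, w) \<in> set (vwalk_arcs (xs @ u # w # zs))"
  using set_vwalk_arcs_append2[of "u # w # zs" xs] by auto

lemma split_two:
  assumes "u \<in> set L" "w \<in> set L" "u \<noteq> w"
  obtains xs ys zs where "L = xs @ u # ys @ w # zs" | xs ys zs where "L = xs @ w # ys @ u # zs"
proof -
  obtain xs rs where L: "L = xs @ u # rs" using assms(1) by (meson split_list)
  then consider "w \<in> set rs" | "w \<in> set xs" using assms(2,3) by auto
  then show ?thesis
  proof cases
    case 1
    then obtain ys zs where "rs = ys @ w # zs" by (meson split_list)
    then show ?thesis using that(1) L by simp
  next
    case 2
    then obtain ys zs where "xs = ys @ w # zs" by (meson split_list)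
    then show ?thesis using that(2) L by simp
  qed
qed

text \<open>A chord at \<open>v\<close> would have to end in \<open>a\<close> or \<open>b\<close>,
  where the cycle already has edges; a chord between path vertices contradicts
  \<open>induced\<close>.\<close>

lemma hole_free_padj:
  assumes G: "pair_graph G" and "chordal G"
  shows "hole_free (padj G)"
  unfolding hole_free_def
proof (intro allI impI, elim conjE, rule ccontr)
  fix v a b M c d
  assume va: "padj G v a" and vb: "padj G v b" and "a \<noteq> b" and M: "\<forall>m \<in> M. m \<noteq> v \<and> \<not> padj G v m"
    and c: "c \<in> M" "padj G a c" and d: "d \<in> ccomp (padj G) M c" "padj G d b"
    and nab: "\<not> padj G a b"
  interpret pair_graph G by (rule G)
  have sym: "padj G y x" if "padj G x y" for x y using that by (rule arcs_symmetric)
  obtain q0 where q0: "set q0 \<subseteq> M" "successively (padj G) (a # q0)" "q0 \<noteq> []" "last q0 = d"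
    using ccomp_walk[OF d(1) c] by blast
  have "successively (padj G) ((a # q0) @ [b])"
    using q0 d(2) by (subst successively_append_iff) simp
  then have w0: "successively (padj G) (a # q0 @ [b])" by simp
  have "a \<notin> M" "b \<notin> M" using M va vb by auto
  from shortest_walk[OF q0(1) w0 this \<open>a \<noteq> b\<close> nab]
  obtain q where q: "set q \<subseteq> M" "successively (padj G) (a # q @ [b])" "q \<noteq> []"
      "distinct (a # q @ [b])"
    and induced: "\<And>xs u ys w zs. a # q @ [b] = xs @ u # ys @ w # zs \<Longrightarrow> padj G u w \<Longrightarrow> ys = []"
    by blast
  let ?L = "a # q @ [b]"
  let ?p = "v # ?L @ [v]"
  let ?es = "vwalk_arcs ?p"
  have "successively (padj G) (?L @ [v])"
    using q(2) sym[OF vb] by (subst successively_append_iff) simp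
  then have succ: "successively (padj G) ?p" using va by simp
  have "v \<in> pverts G" using va by (rule in_arcsD1)
  from awalk_vwalk_arcs[OF succ this]
  have walk: "awalk v ?es v" "pawalk_verts v ?es = ?p" by simp_all
  have "v \<noteq> a" "v \<noteq> b" "v \<notin> set q" using va vb padj_irrefl M q(1) by auto
  then have "distinct (tl (pawalk_verts v ?es))" using q(4) unfolding walk(2) by auto
  then have "cycle ?es" using walk(1) unfolding cycle_def by (auto intro!: exI[of _ v])
  \<comment> \<open>The closed walk lists \<open>v\<close>, \<open>a\<close>, \<open>q\<close>,
    \<open>b\<close>, \<open>v\<close>, hence has \<open>length q + 3\<close> arcs;
    \<open>q \<noteq> []\<close> makes this at least 4.\<close>
  moreover have "length ?es = length ?p - 1" by (metis vwalk_length_def vwalk_length_simp)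
  then have "length ?es = length q + 3" unfolding length_append length_Cons list.size by simp
  then have "length ?es \<ge> 4" using length_greater_0_conv[of q] q(3) by linarith
  ultimately obtain u w where uw: "u \<in> fst ` set ?es" "w \<in> fst ` set ?es" "padj G u w"
      "(u, w) \<notin> set ?es" "(w, u) \<notin> set ?es"
    using \<open>chordal G\<close> unfolding chordal_def by blast
  have verts: "fst ` set ?es = insert v (set ?L)"
    using fst_set_vwalk_arcs[of "v # ?L" v] by simp
  have v_case: "(v, x) \<in> set ?es \<or> (x, v) \<in> set ?es" if x: "x \<in> set ?L" "padj G v x" for x
  proof -
    have "x = a \<or> x = b" using x M q(1) by auto
    then show ?thesis
      using consecutive_in_vwalk_arcs[of v a "[]" "q @ [b, v]"]
        consecutive_in_vwalk_arcs[of b v "v # a # q" "[]"] by auto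
  qed
  have ordered: "(x, y) \<in> set ?es" if "?L = xs @ x # ys @ y # zs" "padj G x y" for x y xs ys zs
  proof -
    have "ys = []" by (rule induced[OF that])
    then have "?p = (v # xs) @ x # y # (zs @ [v])" using that(1) by simp
    then show ?thesis using consecutive_in_vwalk_arcs[of x y "v # xs" "zs @ [v]"] by metis
  qed
  have "u \<noteq> w" using uw(3) padj_irrefl by auto
  show False
  proof (cases "u = v \<or> w = v")
    case True
    then show False using uw \<open>u \<noteq> w\<close> v_case[of u] v_case[of w] sym[of u w] unfolding verts by auto
  next
    case False
    then have "u \<in> set ?L" "w \<in> set ?L" using uw(1,2) unfolding verts by auto
    then show False using split_two[OF _ _ \<open>u \<noteq> w\<close>] ordered uw(3-5) sym[OF uw(3)] by metis
  qed
qed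

section \<open>The r-independence complex in terms of adjacency\<close>

lemma (in pair_graph) scc_of_induce_subgraph:
  assumes "u \<in> A"
  shows "pre_digraph.scc_of (with_proj G \<restriction> A) u = ccomp (padj G) A u"
proof -
  interpret GA: wf_digraph "with_proj G \<restriction> A" by (rule wellformed_induce_subgraph)
  have arc: "x \<rightarrow>\<^bsub>with_proj G \<restriction> A\<^esub> y \<longleftrightarrow> x \<in> A \<and> y \<in> A \<and> padj G x y" for x y
    by (auto simp: arcs_ends_def arc_to_ends_def)
  have to: "x \<rightarrow>\<^sup>*\<^bsub>with_proj G \<restriction> A\<^esub> y" if x: "x \<in> A" "y \<in> ccomp (padj G) A x" for x y
  proof -
    have "ccomp (padj G) A x \<subseteq> {y. x \<rightarrow>\<^sup>*\<^bsub>with_proj G \<restriction> A\<^esub> y}"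
    proof (rule ccomp_closed)
      show "x \<in> {y. x \<rightarrow>\<^sup>*\<^bsub>with_proj G \<restriction> A\<^esub> y}" using x(1) by simp
      fix v w assume "v \<in> {y. x \<rightarrow>\<^sup>*\<^bsub>with_proj G \<restriction> A\<^esub> y}" "v \<in> A" "w \<in> A" "padj G v w"
      then show "w \<in> {y. x \<rightarrow>\<^sup>*\<^bsub>with_proj G \<restriction> A\<^esub> y}"
        using GA.reachable_adj_trans[of x v w] arc by auto
    qed
    then show ?thesis using x(2) by auto
  qed
  have "y \<in> ccomp (padj G) A u" if "u \<rightarrow>\<^sup>*\<^bsub>with_proj G \<restriction> A\<^esub> y" for y
    using that
  proof (induction rule: GA.reachable_induct)
    case (step x y)
    then show ?case using arc ccomp_step[of x "padj G" A u y] by auto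
  qed (rule ccomp_self)
  \<comment> \<open>Symmetry supplies the way back, so one-sided reachability gives the strong
    component.\<close>
  moreover have "y \<rightarrow>\<^sup>*\<^bsub>with_proj G \<restriction> A\<^esub> u" if "y \<in> ccomp (padj G) A u" for y
    using that ccomp_sym[OF symp_padj that] ccomp_subset[OF assms] to by blast
  ultimately show ?thesis using to[OF assms] by (auto simp: GA.scc_of_def)
qed

lemma (in pair_graph) r_independent_iff:
  "r_independent r G A \<longleftrightarrow> A \<subseteq> pverts G \<and> r_indep r (padj G) A"
proof -
  interpret GA: wf_digraph "with_proj G \<restriction> A" by (rule wellformed_induce_subgraph)
  have "(\<forall>C \<in> GA.sccs. card (verts C) \<le> r) \<longleftrightarrow> (\<forall>K \<in> GA.sccs_verts. card K \<le> r)"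
    by (simp add: GA.sccs_verts_conv)
  also have "\<dots> \<longleftrightarrow> (\<forall>u \<in> A. card (GA.scc_of u) \<le> r)"
    by (auto simp: GA.sccs_verts_conv_scc_of)
  also have "\<dots> \<longleftrightarrow> r_indep r (padj G) A"
    by (simp add: r_indep_def scc_of_induce_subgraph)
  finally show ?thesis by (simp add: r_independent_def)
qed

text \<open>The starting point of the recursion: nothing forced, everything undecided.\<close>

lemma (in pair_graph) Ind_eq_r_ext: "Ind r G = r_ext r (padj G) {} (pverts G)"
  by (auto simp: Ind_def r_ext_def r_independent_iff)

section \<open>The structure of CCG(H, V(H), t)\<close>

lemma star_clique_outer:
  assumes "star_clique x K" "p \<in> pverts K - {x}"
  shows "padj K p x"
    and "padj K p q \<Longrightarrow> padj K p q' \<Longrightarrow> q \<noteq> q' \<Longrightarrow> padj K q q'"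
proof -
  obtain \<B> where \<B>: "\<forall>B \<in> \<B>. x \<in> B" "pairwise (\<lambda>B C. B \<inter> C = {x}) \<B>" "pverts K = \<Union>\<B>"
    "parcs K = {(u, v). u \<noteq> v \<and> (\<exists>B \<in> \<B>. u \<in> B \<and> v \<in> B)}"
    using assms(1) unfolding star_clique_def by auto
  show "padj K p x" using \<B>(1,3) assms(2) unfolding \<B>(4) by auto
  assume q: "padj K p q" "padj K p q'" "q \<noteq> q'"
  then obtain B B' where B: "B \<in> \<B>" "B' \<in> \<B>" "p \<in> B" "q \<in> B" "p \<in> B'" "q' \<in> B'"
    unfolding \<B>(4) by auto
  \<comment> \<open>Distinct cliques share only the center, so all neighbours of \<open>p\<close>
    come from one clique.\<close>
  have "B = B'"
  proof (rule ccontr)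
    assume "B \<noteq> B'"
    then have "B \<inter> B' = {x}" using \<B>(2) B(1,2) by (auto simp: pairwise_def)
    then show False using B(3,5) assms(2) by auto
  qed
  then show "padj K q q'" using B q(3) unfolding \<B>(4) by auto
qed

text \<open>This extracts what the locale asks of G, with \<open>V x\<close> the vertex set of the
  attached graph. That G is a simple graph is derived, as \<open>ccg\<close> does not assert
  it.\<close>

lemma ccg_structure:
  assumes H: "pair_graph H" and ccg: "ccg H (pverts H) t G"
  obtains V where "pair_graph G" "pverts G = pverts H \<union> (\<Union>x \<in> pverts H. V x - {x})"
    "\<And>x. x \<in> pverts H \<Longrightarrow> finite (V x) \<and> V x \<inter> pverts H = {x} \<and> t + 1 \<le> card (V x)"
    "\<And>x y. x \<in> pverts H \<Longrightarrow> y \<in> pverts H \<Longrightarrow> x \<noteq> y \<Longrightarrow> V x \<inter> V y = {}"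
    "\<And>x p. x \<in> pverts H \<Longrightarrow> p \<in> V x - {x} \<Longrightarrow>
      padj G p x \<and> simplicial_vertex (padj G) p \<and> {q. padj G p q} \<subseteq> V x"
    "\<And>x. x \<in> pverts H \<Longrightarrow> {q. padj G x q} \<subseteq> V x \<union> pverts H"
    "\<And>x y. x \<in> pverts H \<Longrightarrow> y \<in> pverts H \<Longrightarrow> padj G x y \<longleftrightarrow> padj H x y"
proof -
  interpret H: pair_graph H by (rule H)
  from ccg obtain K where K: "\<forall>x \<in> pverts H. star_clique x (K x) \<and> card (pverts (K x)) \<ge> t + 1 \<and>
           pverts (K x) \<inter> pverts H = {x}"
      "\<forall>x \<in> pverts H. \<forall>y \<in> pverts H. x \<noteq> y \<longrightarrow> pverts (K x) \<inter> pverts (K y) = {}"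
    and vG: "pverts G = pverts H \<union> (\<Union>x \<in> pverts H. pverts (K x))"
    and aG: "parcs G = parcs H \<union> (\<Union>x \<in> pverts H. parcs (K x))"
    unfolding ccg_def by (elim conjE exE)
  have star: "star_clique x (K x)" and card: "card (pverts (K x)) \<ge> t + 1"
    and center: "pverts (K x) \<inter> pverts H = {x}" if "x \<in> pverts H" for x
    using K(1) that by simp_all
  have disjoint: "pverts (K x) \<inter> pverts (K y) = {}"
    if "x \<in> pverts H" "y \<in> pverts H" "x \<noteq> y" for x y
    using K(2) that by simp
  have pg: "pair_graph (K x)" if "x \<in> pverts H" for x
    using star[OF that] by (simp add: star_clique_def)
  have Kv: "u \<in> pverts (K x)" "v \<in> pverts (K x)" if "x \<in> pverts H" "padj (K x) u v" for x u v
  proof -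
    interpret K: pair_graph "K x" by (rule pg[OF that(1)])
    show "u \<in> pverts (K x)" "v \<in> pverts (K x)" using that(2) K.in_arcsD1 K.in_arcsD2 by auto
  qed
  have Kfin: "finite (pverts (K x))" "finite (parcs (K x))" if "x \<in> pverts H" for x
  proof -
    interpret K: pair_graph "K x" by (rule pg[OF that])
    show "finite (pverts (K x))" "finite (parcs (K x))"
      by (rule K.pair_finite_verts, rule K.pair_finite_arcs)
  qed
  have Ksym: "padj (K x) v u" and Kirr: "u \<noteq> v" if "x \<in> pverts H" "padj (K x) u v" for x u v
  proof -
    interpret K: pair_graph "K x" by (rule pg[OF that(1)])
    show "padj (K x) v u" using that(2) by (rule K.arcs_symmetric)
    show "u \<noteq> v" using that(2) K.padj_irrefl by auto
  qed
  have "pair_graph G"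
  proof
    fix e assume e: "e \<in> parcs G"
    obtain u v where uv: "e = (u, v)" by (cases e)
    consider "padj H u v" | x where "x \<in> pverts H" "padj (K x) u v" using e unfolding uv aG by auto
    then have "u \<in> pverts G \<and> v \<in> pverts G \<and> u \<noteq> v"
    proof cases
      case 1
      then show ?thesis using H.in_arcsD1 H.in_arcsD2 H.padj_irrefl unfolding vG by auto
    next
      case (2 x)
      then show ?thesis using Kv[OF 2] Kirr[OF 2] unfolding vG by auto
    qed
    then show "fst e \<in> pverts G" "snd e \<in> pverts G" "fst e \<noteq> snd e" unfolding uv by simp_all
  next
    show "finite (pverts G)" "finite (parcs G)"
      unfolding vG aG using Kfin H.pair_finite_verts H.pair_finite_arcs by auto
    show "symmetric (with_proj G)"
      unfolding symmetric_def with_proj_simps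
      by (rule symI) (auto simp: aG intro: Ksym H.arcs_symmetric)
  qed
  have in_unique: "x = y" if "x \<in> pverts H" "y \<in> pverts H" "p \<in> pverts (K x)" "p \<in> pverts (K y)" for x y p
    using disjoint[OF that(1,2)] that(3,4) by auto
  \<comment> \<open>A new vertex lies neither in H nor in another star-clique, so all its arcs come
    from its own.\<close>
  have outer_arc: "padj G p q \<longleftrightarrow> padj (K x) p q"
    if x: "x \<in> pverts H" "p \<in> pverts (K x) - {x}" for x p q
  proof -
    have "p \<notin> pverts H" using center[OF x(1)] x(2) by auto
    then have "\<not> padj H p q" using H.in_arcsD1 by auto
    moreover have "y = x" if "y \<in> pverts H" "padj (K y) p q" for y
      using in_unique[OF that(1) x(1)] Kv(1)[OF that] x(2) by auto
    ultimately show ?thesis using x(1) unfolding aG by auto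
  qed
  show ?thesis
  proof (rule that[of "\<lambda>x. pverts (K x)"])
    show "pair_graph G" by fact
    show "pverts G = pverts H \<union> (\<Union>x \<in> pverts H. pverts (K x) - {x})"
      unfolding vG by auto
    show "finite (pverts (K x)) \<and> pverts (K x) \<inter> pverts H = {x} \<and> t + 1 \<le> card (pverts (K x))"
      if "x \<in> pverts H" for x
      using Kfin(1) center card that by blast
    show "pverts (K x) \<inter> pverts (K y) = {}" if "x \<in> pverts H" "y \<in> pverts H" "x \<noteq> y" for x y
      using disjoint that by blast
    show "padj G p x \<and> simplicial_vertex (padj G) p \<and> {q. padj G p q} \<subseteq> pverts (K x)"
      if x: "x \<in> pverts H" and p: "p \<in> pverts (K x) - {x}" for x p
    proof (intro conjI)
      show "padj G p x" using star_clique_outer(1)[OF star[OF x] p] outer_arc[OF x p] by simp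
      show "{q. padj G p q} \<subseteq> pverts (K x)" using outer_arc[OF x p] Kv(2)[OF x] by auto
      have "parcs (K x) \<subseteq> parcs G" using x unfolding aG by auto
      then show "simplicial_vertex (padj G) p"
        using star_clique_outer(2)[OF star[OF x] p] outer_arc[OF x p]
        unfolding simplicial_vertex_def by blast
    qed
    show "{q. padj G x q} \<subseteq> pverts (K x) \<union> pverts H" if x: "x \<in> pverts H" for x
    proof
      fix q assume "q \<in> {q. padj G x q}"
      then consider "padj H x q" | y where "y \<in> pverts H" "padj (K y) x q" unfolding aG by auto
      then show "q \<in> pverts (K x) \<union> pverts H"
      proof cases
        case 1
        then show ?thesis using H.in_arcsD2 by auto
      next
        case (2 y)
        have "x \<in> pverts (K y)" using Kv(1)[OF 2] .
        then have "x = y" using center[OF 2(1)] x by auto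
        then show ?thesis using Kv(2)[OF 2] by auto
      qed
    qed
    show "padj G x y \<longleftrightarrow> padj H x y" if "x \<in> pverts H" "y \<in> pverts H" for x y
    proof -
      \<comment> \<open>Each attached graph meets H in a single vertex, so such an arc would be a
        loop.\<close>
      have "\<not> padj (K z) x y" if z: "z \<in> pverts H" for z
      proof
        assume arc: "padj (K z) x y"
        have "x = z" "y = z" using Kv[OF z arc] center[OF z] \<open>x \<in> pverts H\<close> \<open>y \<in> pverts H\<close> by auto
        then show False using Kirr[OF z arc] by simp
      qed
      then show ?thesis unfolding aG by auto
    qed
  qed
qed

theorem theorem5p2:
  fixes H G :: "'a pair_pre_digraph" and t r :: nat
  assumes "pair_graph H" and "chordal H"
    and "t \<ge> 1"
    and "ccg H (pverts H) t G"
    and "r \<ge> 1" and "r \<le> 2 * t + 1"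
  shows "shellable (Ind r G)"
proof -
  interpret H: pair_graph H by (rule assms(1))
  obtain V where V: "pair_graph G" "pverts G = pverts H \<union> (\<Union>x \<in> pverts H. V x - {x})"
    "\<And>x. x \<in> pverts H \<Longrightarrow> finite (V x) \<and> V x \<inter> pverts H = {x} \<and> t + 1 \<le> card (V x)"
    "\<And>x y. x \<in> pverts H \<Longrightarrow> y \<in> pverts H \<Longrightarrow> x \<noteq> y \<Longrightarrow> V x \<inter> V y = {}"
    "\<And>x p. x \<in> pverts H \<Longrightarrow> p \<in> V x - {x} \<Longrightarrow>
      padj G p x \<and> simplicial_vertex (padj G) p \<and> {q. padj G p q} \<subseteq> V x"
    "\<And>x. x \<in> pverts H \<Longrightarrow> {q. padj G x q} \<subseteq> V x \<union> pverts H"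
    "\<And>x y. x \<in> pverts H \<Longrightarrow> y \<in> pverts H \<Longrightarrow> padj G x y \<longleftrightarrow> padj H x y"
    using ccg_structure[OF assms(1,4)] by blast
  interpret G: pair_graph G by (rule V(1))
  interpret star_clique_graph "padj G" "pverts H" V t r
  proof
    \<comment> \<open>Dirac's theorem is applied in H and carried over to G, whose adjacency agrees
      with that of H on \<open>U\<close>.\<close>
    fix U assume U: "U \<subseteq> pverts H" "U \<noteq> {}"
    have "finite U" using U(1) H.pair_finite_verts finite_subset by blast
    then obtain x where x: "x \<in> U" "simplicial_in (padj H) U x"
      using ex_simplicial_in[OF H.symp_padj hole_free_padj[OF assms(1,2)]] U(2) by blast
    have eq: "padj G y z \<longleftrightarrow> padj H y z" if "y \<in> U" "z \<in> U" for y z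
      using U(1) that by (intro V(7)) (rule subsetD, assumption+)+
    show "\<exists>x\<in>U. \<forall>y\<in>U. \<forall>z\<in>U. padj G x y \<and> padj G x z \<and> y \<noteq> z \<longrightarrow> padj G y z"
    proof (rule bexI[OF _ x(1)], intro ballI impI)
      fix y z assume yz: "y \<in> U" "z \<in> U" "padj G x y \<and> padj G x z \<and> y \<noteq> z"
      have "padj H x y \<and> padj H x z \<and> y \<noteq> z"
        using yz(3) unfolding eq[OF x(1) yz(1)] eq[OF x(1) yz(2)] .
      then have "padj H y z" using x(2) yz(1,2) unfolding simplicial_in_def by blast
      then show "padj G y z" unfolding eq[OF yz(1,2)] .
    qed
  next
    show "symp (padj G)" "finite (pverts H)" "r \<le> 2 * t + 1"
      by (rule G.symp_padj, rule H.pair_finite_verts, rule assms(6))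
    fix x assume x: "x \<in> pverts H"
    show "finite (V x)" "V x \<inter> pverts H = {x}" "t + 1 \<le> card (V x)" using V(3)[OF x] by simp_all
    show "{q. padj G x q} \<subseteq> V x \<union> pverts H" by (rule V(6)[OF x])
    show "padj G p x \<and> simplicial_vertex (padj G) p \<and> {q. padj G p q} \<subseteq> V x"
      if "p \<in> V x - {x}" for p
      by (rule V(5)[OF x that])
    show "V x \<inter> V y = {}" if "y \<in> pverts H" "x \<noteq> y" for y
      by (rule V(4)[OF x that])
  qed
  have "Ind r G = r_ext r (padj G) {} (pverts H \<union> outers)"
    unfolding G.Ind_eq_r_ext V(2) outers_def ..
  then have "has_shelling (Ind r G)" using has_shelling_extensions[of "pverts H" "{}"] by simp
  then show ?thesis
    by (rule has_shelling_imp_shellable[OF simplicial_complex_Ind[OF V(1)]])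
qed

end
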